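(* Let $p$ be a prime and let $x\in\overline{\mathbb{F}}_p((t^{\mathbb{Q}}))$ be algebraic over $\mathbb{F}_p((t))$. Let $n$ be the degree of $x$ over $\mathbb{F}_p((t))$ and let $m=n(n+1)/2+1$. Then the support of $x$ has order type at most $\omega^m$.
   Context: For a field $K$ and an ordered abelian group $\Gamma$, $K((t^\Gamma))$ denotes the Hahn field of generalised power series $x=\sum_{\gamma\in S_x}a_\gamma t^\gamma$ with $a_\gamma\in K$ and $S_x\subseteq\Gamma$ well ordered; $K((t))=K((t^{\mathbb{Z}}))$. The support of $x=\sum_\gamma a_\gamma t^\gamma$ is the well-ordered set $\{\gamma\in\Gamma \mid a_\gamma\neq 0\}$, and the order type of $x$ means the order type (an ordinal) of its support. $\overline{\mathbb{F}}_p$ is the algebraic closure of $\mathbb{F}_p$. The power $\omega^m$ is ordinal exponentiation. *)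

theory Defs
  imports
    "HOL-Algebra.Algebraic_Closure_Type"
    "HOL-Computational_Algebra.Formal_Laurent_Series"
    "Berlekamp_Zassenhaus.Finite_Field"
begin

section \<open>Well-ordered subsets of a linear order\<close>

definition le_on :: "'g::linorder set \<Rightarrow> 'g rel"
  where "le_on S = {(a, b). a \<in> S \<and> b \<in> S \<and> a \<le> b}"

definition well_ordered :: "'g::linorder set \<Rightarrow> bool"
  where "well_ordered S \<longleftrightarrow> well_order_on S (le_on S)"

lemma linear_order_le_on: "linear_order_on S (le_on S)"
  by (auto simp: linear_order_on_def partial_order_on_def preorder_on_def refl_on_def trans_def
      antisym_def total_on_def le_on_def)

lemma well_ordered_iff_wf: "well_ordered S \<longleftrightarrow> wf (le_on S - Id)"
  by (auto simp: well_ordered_def well_order_on_def linear_order_le_on)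

lemma well_ordered_iff_no_descent:
  "well_ordered S \<longleftrightarrow> (\<nexists>s :: nat \<Rightarrow> 'g::linorder. range s \<subseteq> S \<and> (\<forall>n. s (Suc n) < s n))"
  unfolding well_ordered_iff_wf wf_iff_no_infinite_down_chain
proof (rule arg_cong[where f = Not], rule arg_cong[where f = Ex], rule ext)
  fix s :: "nat \<Rightarrow> 'g"
  have "(\<forall>n. (s (Suc n), s n) \<in> le_on S - Id) \<longleftrightarrow> (\<forall>n. s (Suc n) \<in> S \<and> s n \<in> S \<and> s (Suc n) < s n)"
    by (auto simp: le_on_def less_le)
  then show "(\<forall>n. (s (Suc n), s n) \<in> le_on S - Id) \<longleftrightarrow> (range s \<subseteq> S \<and> (\<forall>n. s (Suc n) < s n))"
    by blast
qed

lemma well_ordered_no_strict_antimono: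
  assumes "well_ordered S" and "\<And>n::nat. s n \<in> S" and "\<And>m n. m < n \<Longrightarrow> s n < s m"
  shows False
  using assms by (auto simp: well_ordered_iff_no_descent)

lemma well_ordered_subset: "well_ordered S \<Longrightarrow> T \<subseteq> S \<Longrightarrow> well_ordered T"
  unfolding well_ordered_iff_no_descent by blast

lemma well_ordered_empty [simp]: "well_ordered {}"
  by (auto simp: well_ordered_iff_no_descent)

lemma well_ordered_singleton [simp]: "well_ordered {a}"
  unfolding well_ordered_iff_no_descent by (force simp: image_subset_iff)

lemma well_ordered_mono_subseq:
  assumes "well_ordered S" and "\<And>n::nat. s n \<in> S"
  obtains f where "strict_mono f" and "mono (\<lambda>n::nat. s (f n))"
proof -
  obtain f where f: "strict_mono f" "monoseq (\<lambda>n. s (f n))"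
    using seq_monosub by blast
  show thesis
  proof (cases "incseq (\<lambda>n. s (f n))")
    case True
    then show thesis using f that by blast
  next
    case False
    then have dec: "decseq (\<lambda>n. s (f n))"
      using f by (simp add: monoseq_iff)
    define a where "a = (\<lambda>n. s (f n))"
    have "wf (le_on S - Id)"
      using assms(1) by (simp add: well_ordered_iff_wf)
    then obtain z where z: "z \<in> range a" "\<And>y. (y, z) \<in> le_on S - Id \<Longrightarrow> y \<notin> range a"
      using wfE_min[of "le_on S - Id" "a 0" "range a"] by blast
    then obtain N where N: "z = a N" by blast
    have "a n = z" if "n \<ge> N" for n
      using z(2)[of "a n"] dec that N assms(2) unfolding decseq_def a_def
      by (auto simp: le_on_def)
    then have "strict_mono (\<lambda>n. f (n + N))" "mono (\<lambda>n. s (f (n + N)))"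
      using f(1) by (auto simp: strict_mono_def mono_def a_def)
    then show thesis by (rule that)
  qed
qed

lemma well_ordered_Un:
  assumes "well_ordered S" "well_ordered T"
  shows "well_ordered (S \<union> T)"
  unfolding well_ordered_iff_no_descent
proof
  assume "\<exists>s :: nat \<Rightarrow> 'a. range s \<subseteq> S \<union> T \<and> (\<forall>n. s (Suc n) < s n)"
  then obtain s :: "nat \<Rightarrow> 'a" where s: "range s \<subseteq> S \<union> T" "\<And>n. s (Suc n) < s n" by blast
  have anti: "s n < s m" if "m < n" for m n
    using that by (induction n) (auto simp: less_Suc_eq intro: s(2) order.strict_trans)
  have *: False if U: "well_ordered U" and inf: "infinite {n. s n \<in> U}" for U
  proof -
    obtain r :: "nat \<Rightarrow> nat" where "strict_mono r" "\<And>n. r n \<in> {n. s n \<in> U}"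
      using infinite_enumerate[OF inf] by blast
    then show False
      using well_ordered_no_strict_antimono[OF U, of "\<lambda>n. s (r n)"] anti
      by (auto simp: strict_mono_def)
  qed
  have "{n. s n \<in> S} \<union> {n. s n \<in> T} = UNIV" using s(1) by blast
  then have "infinite {n. s n \<in> S} \<or> infinite {n. s n \<in> T}"
    by (metis finite_Un infinite_UNIV_nat)
  then show False using * assms by blast
qed

lemma well_ordered_sums:
  fixes S T :: "'g::linordered_ab_group_add set"
  assumes "well_ordered S" "well_ordered T"
  shows "well_ordered {a + b |a b. a \<in> S \<and> b \<in> T}"
  unfolding well_ordered_iff_no_descent
proof
  assume "\<exists>s :: nat \<Rightarrow> 'g. range s \<subseteq> {a + b |a b. a \<in> S \<and> b \<in> T} \<and> (\<forall>n. s (Suc n) < s n)"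
  then obtain s :: "nat \<Rightarrow> 'g" where s: "range s \<subseteq> {a + b |a b. a \<in> S \<and> b \<in> T}" "\<And>n. s (Suc n) < s n"
    by blast
  have anti: "s n < s m" if "m < n" for m n
    using that by (induction n) (auto simp: less_Suc_eq intro: s(2) order.strict_trans)
  have "\<forall>n. \<exists>a b. s n = a + b \<and> a \<in> S \<and> b \<in> T" using s(1) by blast
  then obtain a b where ab: "\<And>n. s n = a n + b n" "\<And>n. a n \<in> S" "\<And>n. b n \<in> T" by metis
  obtain f where f: "strict_mono f" "mono (\<lambda>n::nat. a (f n))"
    using well_ordered_mono_subseq[OF assms(1), of a] ab(2) by blast
  have "b (f n) < b (f m)" if "m < n" for m n
  proof -
    have "a (f m) \<le> a (f n)" using f(2) that by (simp add: mono_def)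
    moreover have "a (f n) + b (f n) < a (f m) + b (f m)"
      using anti[of "f m" "f n"] f(1) that by (simp add: strict_mono_def ab(1))
    ultimately show ?thesis
      by (meson add_le_less_mono add_mono linorder_not_less order.strict_trans2)
  qed
  then show False
    using well_ordered_no_strict_antimono[OF assms(2), of "\<lambda>n. b (f n)"] ab(3) by blast
qed

lemma finite_sum_decompositions:
  fixes S T :: "'g::linordered_ab_group_add set"
  assumes "well_ordered S" "well_ordered T"
  shows "finite {a \<in> S. g - a \<in> T}"
proof (rule ccontr)
  assume "infinite {a \<in> S. g - a \<in> T}"
  then obtain a :: "nat \<Rightarrow> 'g" where a: "inj a" "range a \<subseteq> {a \<in> S. g - a \<in> T}"
    using infinite_countable_subset by blast
  then have a': "\<And>n. a n \<in> S" "\<And>n. g - a n \<in> T" by auto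
  obtain f where f: "strict_mono f" "mono (\<lambda>n::nat. a (f n))"
    using well_ordered_mono_subseq[OF assms(1), of a] a'(1) by blast
  have "g - a (f n) < g - a (f m)" if "m < n" for m n
  proof -
    have "a (f m) \<le> a (f n)" using f(2) that by (simp add: mono_def)
    moreover have "a (f m) \<noteq> a (f n)"
      using a(1) f(1) that by (metis injD strict_mono_def less_irrefl)
    ultimately show ?thesis by simp
  qed
  then show False
    using well_ordered_no_strict_antimono[OF assms(2), of "\<lambda>n. g - a (f n)"] a'(2) by blast
qed


section \<open>Hahn series\<close>

typedef (overloaded) ('k::zero, 'g::linordered_ab_group_add) hahn =
  "{x :: 'g \<Rightarrow> 'k. well_ordered {g. x g \<noteq> 0}}"
  morphisms hahn_nth Abs_hahn
  by (rule exI[of _ "\<lambda>_. 0"]) simp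

setup_lifting type_definition_hahn

definition hahn_supp :: "('k::zero, 'g::linordered_ab_group_add) hahn \<Rightarrow> 'g set"
  where "hahn_supp x = {g. hahn_nth x g \<noteq> 0}"

text \<open>The order type of \<open>x\<close> is the isomorphism class of this well-order.\<close>

definition supp_order :: "('k::zero, 'g::linordered_ab_group_add) hahn \<Rightarrow> 'g rel"
  where "supp_order x = le_on (hahn_supp x)"

lemma well_ordered_supp: "well_ordered (hahn_supp x)"
  using hahn_nth[of x] by (simp add: hahn_supp_def)

lemma Well_order_supp_order: "Well_order (supp_order x)"
  using well_ordered_supp[of x] well_order_on_Well_order
  unfolding well_ordered_def supp_order_def by fastforce

lemma hahn_eqI: "(\<And>g. hahn_nth x g = hahn_nth y g) \<Longrightarrow> x = y"
  by transfer auto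

lemma hahn_nth_eq_0_iff: "hahn_nth x g = 0 \<longleftrightarrow> g \<notin> hahn_supp x"
  by (simp add: hahn_supp_def)

instantiation hahn :: (zero, linordered_ab_group_add) zero
begin
lift_definition zero_hahn :: "('a, 'b) hahn" is "\<lambda>_. 0" by simp
instance ..
end

instantiation hahn :: (zero_neq_one, linordered_ab_group_add) one
begin
lift_definition one_hahn :: "('a, 'b) hahn" is "\<lambda>g. if g = 0 then 1 else 0" by simp
instance ..
end

instantiation hahn :: (ab_group_add, linordered_ab_group_add) ab_group_add
begin
lift_definition plus_hahn :: "('a, 'b) hahn \<Rightarrow> ('a, 'b) hahn \<Rightarrow> ('a, 'b) hahn"
  is "\<lambda>x y g. x g + y g"
  by (rule well_ordered_subset, rule well_ordered_Un, assumption, assumption) auto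
lift_definition uminus_hahn :: "('a, 'b) hahn \<Rightarrow> ('a, 'b) hahn"
  is "\<lambda>x g. - x g"
  by simp
definition minus_hahn :: "('a, 'b) hahn \<Rightarrow> ('a, 'b) hahn \<Rightarrow> ('a, 'b) hahn"
  where "minus_hahn x y = x + - y"
instance
  by standard (unfold minus_hahn_def, (transfer, simp add: add_ac)+)
end

lemma sum_decompositions_cong:
  fixes x y :: "'g::linordered_ab_group_add \<Rightarrow> 'k::semiring_0"
  assumes "well_ordered S" "well_ordered T" "{g. x g \<noteq> 0} \<subseteq> S" "{g. y g \<noteq> 0} \<subseteq> T"
  shows "(\<Sum>a | x a \<noteq> 0 \<and> y (g - a) \<noteq> 0. x a * y (g - a)) = (\<Sum>a | a \<in> S \<and> g - a \<in> T. x a * y (g - a))"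
proof (rule sum.mono_neutral_left)
  show "finite {a. a \<in> S \<and> g - a \<in> T}"
    using finite_sum_decompositions[OF assms(1,2)] by simp
  show "{a. x a \<noteq> 0 \<and> y (g - a) \<noteq> 0} \<subseteq> {a. a \<in> S \<and> g - a \<in> T}"
    using assms(3,4) by blast
  show "\<forall>a \<in> {a. a \<in> S \<and> g - a \<in> T} - {a. x a \<noteq> 0 \<and> y (g - a) \<noteq> 0}. x a * y (g - a) = 0"
  proof
    fix a assume "a \<in> {a. a \<in> S \<and> g - a \<in> T} - {a. x a \<noteq> 0 \<and> y (g - a) \<noteq> 0}"
    then have "x a = 0 \<or> y (g - a) = 0" by blast
    then show "x a * y (g - a) = 0" by (elim disjE) simp_all
  qed
qed

instantiation hahn :: ("{semiring_0}", linordered_ab_group_add) times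
begin
lift_definition times_hahn :: "('a, 'b) hahn \<Rightarrow> ('a, 'b) hahn \<Rightarrow> ('a, 'b) hahn"
  is "\<lambda>x y g. \<Sum>a | x a \<noteq> 0 \<and> y (g - a) \<noteq> 0. x a * y (g - a)"
proof -
  fix x y :: "'b \<Rightarrow> 'a"
  assume wo: "well_ordered {g. x g \<noteq> 0}" "well_ordered {g. y g \<noteq> 0}"
  show "well_ordered {g. (\<Sum>a | x a \<noteq> 0 \<and> y (g - a) \<noteq> 0. x a * y (g - a)) \<noteq> 0}"
  proof (rule well_ordered_subset[OF well_ordered_sums[OF wo]], rule subsetI)
    fix g assume "g \<in> {g. (\<Sum>a | x a \<noteq> 0 \<and> y (g - a) \<noteq> 0. x a * y (g - a)) \<noteq> 0}"
    then have "(\<Sum>a | x a \<noteq> 0 \<and> y (g - a) \<noteq> 0. x a * y (g - a)) \<noteq> 0" by blast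
    then obtain a where "x a \<noteq> 0" "y (g - a) \<noteq> 0"
      by (elim sum.not_neutral_contains_not_neutral) blast
    moreover have "g = a + (g - a)" by simp
    ultimately show "g \<in> {a + b |a b. a \<in> {g. x g \<noteq> 0} \<and> b \<in> {g. y g \<noteq> 0}}"
      by blast
  qed
qed
instance ..
end

lemma hahn_nth_times:
  assumes "well_ordered S" "well_ordered T" "hahn_supp x \<subseteq> S" "hahn_supp y \<subseteq> T"
  shows "hahn_nth (x * y) g = (\<Sum>a | a \<in> S \<and> g - a \<in> T. hahn_nth x a * hahn_nth y (g - a))"
  using sum_decompositions_cong[of S T "hahn_nth x" "hahn_nth y" g] assms
  by (simp add: times_hahn.rep_eq hahn_supp_def)

lemma hahn_supp_times: "hahn_supp (x * y) \<subseteq> {a + b |a b. a \<in> hahn_supp x \<and> b \<in> hahn_supp y}"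
proof
  fix g assume "g \<in> hahn_supp (x * y)"
  then have "(\<Sum>a | hahn_nth x a \<noteq> 0 \<and> hahn_nth y (g - a) \<noteq> 0. hahn_nth x a * hahn_nth y (g - a)) \<noteq> 0"
    by (simp add: hahn_supp_def times_hahn.rep_eq)
  then obtain a where "hahn_nth x a \<noteq> 0" "hahn_nth y (g - a) \<noteq> 0"
    by (elim sum.not_neutral_contains_not_neutral) blast
  moreover have "g = a + (g - a)" by simp
  ultimately show "g \<in> {a + b |a b. a \<in> hahn_supp x \<and> b \<in> hahn_supp y}"
    unfolding hahn_supp_def by blast
qed

instance hahn :: (comm_ring_1, linordered_ab_group_add) comm_ring_1
proof
  fix x y z :: "('a, 'b) hahn"
  define A B C where "A = hahn_supp x" and "B = hahn_supp y" and "C = hahn_supp z"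
  have wo: "well_ordered A" "well_ordered B" "well_ordered C"
    by (simp_all add: A_def B_def C_def well_ordered_supp)
  show comm: "x * y = y * x" for x y :: "('a, 'b) hahn"
  proof (rule hahn_eqI)
    fix g
    show "hahn_nth (x * y) g = hahn_nth (y * x) g"
      unfolding times_hahn.rep_eq
      by (rule sum.reindex_bij_witness[of _ "\<lambda>a. g - a" "\<lambda>a. g - a"]) (auto simp: mult.commute)
  qed
  show "x * y * z = x * (y * z)"
  proof (rule hahn_eqI)
    fix g
    define AB where "AB = {a + b |a b. a \<in> A \<and> b \<in> B}"
    define BC where "BC = {a + b |a b. a \<in> B \<and> b \<in> C}"
    have wo': "well_ordered AB" "well_ordered BC"
      unfolding AB_def BC_def using wo by (auto intro: well_ordered_sums)
    have sub: "hahn_supp (x * y) \<subseteq> AB" "hahn_supp (y * z) \<subseteq> BC"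
      unfolding AB_def BC_def A_def B_def C_def by (rule hahn_supp_times)+
    have fin: "finite {a \<in> A. h - a \<in> B}" "finite {a \<in> B. h - a \<in> C}"
       "finite {c \<in> AB. h - c \<in> C}" "finite {a \<in> A. h - a \<in> BC}" for h
      using wo wo' by (auto intro: finite_sum_decompositions)
    have "hahn_nth (x * y * z) g = (\<Sum>c | c \<in> AB \<and> g - c \<in> C. hahn_nth (x * y) c * hahn_nth z (g - c))"
      by (rule hahn_nth_times) (use wo wo' sub in \<open>auto simp: C_def\<close>)
    also have "\<dots> = (\<Sum>c | c \<in> AB \<and> g - c \<in> C. \<Sum>a | a \<in> A \<and> c - a \<in> B.
                     hahn_nth x a * hahn_nth y (c - a) * hahn_nth z (g - c))"
      by (subst hahn_nth_times[of A B x y]) (use wo in \<open>auto simp: A_def B_def sum_distrib_right\<close>)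
    also have "\<dots> = (\<Sum>(c, a) \<in> (SIGMA c:{c. c \<in> AB \<and> g - c \<in> C}. {a. a \<in> A \<and> c - a \<in> B}).
                     hahn_nth x a * hahn_nth y (c - a) * hahn_nth z (g - c))"
      by (rule sum.Sigma) (use fin in auto)
    also have "\<dots> = (\<Sum>(a, b) \<in> (SIGMA a:{a. a \<in> A \<and> g - a \<in> BC}. {b. b \<in> B \<and> g - a - b \<in> C}).
                     hahn_nth x a * (hahn_nth y b * hahn_nth z (g - a - b)))"
      by (rule sum.reindex_bij_witness[of _ "\<lambda>(a, b). (a + b, a)" "\<lambda>(c, a). (a, c - a)"])
         (force simp: AB_def BC_def algebra_simps)+
    also have "\<dots> = (\<Sum>a | a \<in> A \<and> g - a \<in> BC. \<Sum>b | b \<in> B \<and> g - a - b \<in> C.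
                     hahn_nth x a * (hahn_nth y b * hahn_nth z (g - a - b)))"
      by (rule sum.Sigma[symmetric]) (use fin in auto)
    also have "\<dots> = (\<Sum>a | a \<in> A \<and> g - a \<in> BC. hahn_nth x a * hahn_nth (y * z) (g - a))"
      by (subst hahn_nth_times[of B C y z]) (use wo in \<open>auto simp: B_def C_def sum_distrib_left\<close>)
    also have "\<dots> = hahn_nth (x * (y * z)) g"
      by (rule hahn_nth_times[symmetric]) (use wo wo' sub in \<open>auto simp: A_def\<close>)
    finally show "hahn_nth (x * y * z) g = hahn_nth (x * (y * z)) g" .
  qed
  show "1 * x = x"
  proof (rule hahn_eqI)
    fix g
    have supp1: "hahn_supp (1 :: ('a, 'b) hahn) \<subseteq> {0}"
      by (auto simp: hahn_supp_def one_hahn.rep_eq)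
    have "hahn_nth (1 * x) g = (\<Sum>a | a \<in> {0} \<and> g - a \<in> A. hahn_nth 1 a * hahn_nth x (g - a))"
      by (rule hahn_nth_times) (use wo supp1 in \<open>auto simp: A_def\<close>)
    also have "{a. a \<in> {0} \<and> g - a \<in> A} = (if g \<in> A then {0} else {})"
      by auto
    finally show "hahn_nth (1 * x) g = hahn_nth x g"
      by (auto simp: one_hahn.rep_eq A_def hahn_nth_eq_0_iff)
  qed
  show "(x + y) * z = x * z + y * z"
  proof (rule hahn_eqI)
    fix g
    have woU: "well_ordered (A \<union> B)" using wo by (simp add: well_ordered_Un)
    have sub: "hahn_supp (x + y) \<subseteq> A \<union> B"
      by (auto simp: hahn_supp_def A_def B_def plus_hahn.rep_eq)
    show "hahn_nth ((x + y) * z) g = hahn_nth (x * z + y * z) g"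
      using hahn_nth_times[of "A \<union> B" C "x + y" z g] hahn_nth_times[of "A \<union> B" C x z g]
        hahn_nth_times[of "A \<union> B" C y z g] woU wo sub
      by (simp add: A_def B_def C_def plus_hahn.rep_eq distrib_right sum.distrib)
  qed
  show "(0 :: ('a, 'b) hahn) \<noteq> 1"
    by transfer (metis zero_neq_one)
qed

lemma well_ordered_least:
  assumes "well_ordered S" "S \<noteq> {}"
  obtains m where "m \<in> S" "\<And>a. a \<in> S \<Longrightarrow> m \<le> a"
proof -
  have "wf (le_on S - Id)" using assms(1) by (simp add: well_ordered_iff_wf)
  then obtain m where m: "m \<in> S" "\<And>y. (y, m) \<in> le_on S - Id \<Longrightarrow> y \<notin> S"
    using assms(2) wfE_min[of "le_on S - Id" _ S] by blast
  have "m \<le> a" if "a \<in> S" for a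
    using m(1) m(2)[of a] that linear[of m a] by (auto simp: le_on_def)
  then show thesis using m(1) that by blast
qed

instance hahn :: (idom, linordered_ab_group_add) idom
proof
  fix x y :: "('a, 'b) hahn"
  assume nz: "x \<noteq> 0" "y \<noteq> 0"
  have ne: "hahn_supp z \<noteq> {}" if "z \<noteq> 0" for z :: "('a, 'b) hahn"
    using that by (auto simp: hahn_supp_def zero_hahn.rep_eq intro!: hahn_eqI)
  obtain a where a: "a \<in> hahn_supp x" "\<And>c. c \<in> hahn_supp x \<Longrightarrow> a \<le> c"
    using well_ordered_least[OF well_ordered_supp ne[OF nz(1)]] by blast
  obtain b where b: "b \<in> hahn_supp y" "\<And>c. c \<in> hahn_supp y \<Longrightarrow> b \<le> c"
    using well_ordered_least[OF well_ordered_supp ne[OF nz(2)]] by blast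
  have "c = a" if "c \<in> hahn_supp x" "a + b - c \<in> hahn_supp y" for c
  proof -
    have "a \<le> c" "b \<le> a + b - c" using a(2) b(2) that by blast+
    then have "c \<le> a" by (simp add: algebra_simps)
    with \<open>a \<le> c\<close> show ?thesis by simp
  qed
  then have "{c. c \<in> hahn_supp x \<and> a + b - c \<in> hahn_supp y} = {a}"
    using a(1) b(1) by auto
  then have "hahn_nth (x * y) (a + b) = hahn_nth x a * hahn_nth y b"
    by (simp add: hahn_nth_times[OF well_ordered_supp well_ordered_supp order_refl order_refl])
  then have "hahn_nth (x * y) (a + b) \<noteq> 0"
    using a(1) b(1) by (simp add: hahn_supp_def)
  then show "x * y \<noteq> 0"
    by (auto simp: zero_hahn.rep_eq)
qed


section \<open>The embedding of \<open>F((t))\<close> into the Hahn series over an algebraic closure of \<open>F\<close>\<close>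

lift_definition laurent_emb :: "'f::field fls \<Rightarrow> ('f alg_closure, rat) hahn"
  is "\<lambda>f q. if q \<in> \<int> then to_ac (fls_nth f \<lfloor>q\<rfloor>) else 0"
proof -
  fix f :: "'f fls"
  show "well_ordered {q :: rat. (if q \<in> \<int> then to_ac (fls_nth f \<lfloor>q\<rfloor>) else 0) \<noteq> 0}"
    unfolding well_ordered_iff_no_descent
  proof
    assume "\<exists>s :: nat \<Rightarrow> rat. range s \<subseteq> {q. (if q \<in> \<int> then to_ac (fls_nth f \<lfloor>q\<rfloor>) else 0) \<noteq> 0} \<and>
              (\<forall>n. s (Suc n) < s n)"
    then obtain s :: "nat \<Rightarrow> rat"
      where s: "range s \<subseteq> {q. (if q \<in> \<int> then to_ac (fls_nth f \<lfloor>q\<rfloor>) else 0) \<noteq> 0}"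
        "\<And>n. s (Suc n) < s n" by blast
    have int: "s n \<in> \<int>" and nz: "fls_nth f \<lfloor>s n\<rfloor> \<noteq> 0" for n
      using s(1) by (auto simp: image_subset_iff split: if_splits)
    have lt: "\<lfloor>s (Suc n)\<rfloor> < \<lfloor>s n\<rfloor>" for n
      using s(2)[of n] int[of n] int[of "Suc n"] by (auto elim!: Ints_cases)
    have "\<lfloor>s n\<rfloor> \<le> \<lfloor>s 0\<rfloor> - int n" for n
    proof (induction n)
      case (Suc n)
      then show ?case using lt[of n] by simp
    qed simp
    from this[of "nat (\<lfloor>s 0\<rfloor> - fls_subdegree f + 1)"]
    show False
      using fls_subdegree_leI[OF nz[of "nat (\<lfloor>s 0\<rfloor> - fls_subdegree f + 1)"]]
        fls_subdegree_leI[OF nz[of 0]] by simp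
  qed
qed

lemma laurent_emb_0 [simp]: "laurent_emb 0 = 0"
  by transfer auto

lemma laurent_emb_1 [simp]: "laurent_emb 1 = 1"
  by transfer (auto simp: fun_eq_iff elim!: Ints_cases)

lemma laurent_emb_add: "laurent_emb (f + g) = laurent_emb f + laurent_emb g"
  by transfer (auto simp: fun_eq_iff)

lemma laurent_emb_mult: "laurent_emb (f * g) = laurent_emb f * laurent_emb g"
proof (rule hahn_eqI)
  fix q :: rat
  let ?x = "hahn_nth (laurent_emb f)" and ?y = "hahn_nth (laurent_emb g)"
  have non: "hahn_nth (laurent_emb h) r = 0" if "r \<notin> \<int>" for h :: "'a fls" and r
    using that by (simp add: laurent_emb.rep_eq)
  have nth: "hahn_nth (laurent_emb h) (of_int k) = to_ac (fls_nth h k)" for h :: "'a fls" and k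
    by (simp add: laurent_emb.rep_eq)
  show "hahn_nth (laurent_emb (f * g)) q = hahn_nth (laurent_emb f * laurent_emb g) q"
  proof (cases "q \<in> \<int>")
    case False
    have "{a. ?x a \<noteq> 0 \<and> ?y (q - a) \<noteq> 0} = {}"
    proof (rule ccontr)
      assume "{a. ?x a \<noteq> 0 \<and> ?y (q - a) \<noteq> 0} \<noteq> {}"
      then obtain a where "a \<in> \<int>" "q - a \<in> \<int>" using non by blast
      then have "a + (q - a) \<in> \<int>" by (rule Ints_add)
      with False show False by simp
    qed
    then have "hahn_nth (laurent_emb f * laurent_emb g) q = 0"
      unfolding times_hahn.rep_eq by (simp only: sum.empty)
    then show ?thesis using False by (simp add: non)
  next
    case True
    then obtain n where n: "q = of_int n" by (auto elim: Ints_cases)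
    let ?I = "{fls_subdegree f..n - fls_subdegree g}"
    have eq: "{a. ?x a \<noteq> 0 \<and> ?y (q - a) \<noteq> 0} =
            of_int ` {i \<in> ?I. fls_nth f i \<noteq> 0 \<and> fls_nth g (n - i) \<noteq> 0}" (is "?A = ?B")
    proof (intro equalityI subsetI)
      fix a assume a: "a \<in> ?A"
      then obtain i where i: "a = of_int i" using non by (blast elim: Ints_cases)
      have "fls_nth f i \<noteq> 0" "fls_nth g (n - i) \<noteq> 0"
        using a nth[of f i] nth[of g "n - i"] by (auto simp: i n)
      then show "a \<in> ?B"
        using fls_subdegree_leI[of f i] fls_subdegree_leI[of g "n - i"] by (auto simp: i)
    next
      fix a assume "a \<in> ?B"
      then obtain i where "a = of_int i" "fls_nth f i \<noteq> 0" "fls_nth g (n - i) \<noteq> 0" by blast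
      then show "a \<in> ?A"
        using nth[of f i] nth[of g "n - i"] by (simp add: n)
    qed
    have "hahn_nth (laurent_emb f * laurent_emb g) q =
        (\<Sum>a \<in> of_int ` {i \<in> ?I. fls_nth f i \<noteq> 0 \<and> fls_nth g (n - i) \<noteq> 0}. ?x a * ?y (q - a))"
      unfolding times_hahn.rep_eq eq ..
    also have "\<dots> = (\<Sum>i | i \<in> ?I \<and> fls_nth f i \<noteq> 0 \<and> fls_nth g (n - i) \<noteq> 0. to_ac (fls_nth f i * fls_nth g (n - i)))"
      using nth[of g "n - _"] by (subst sum.reindex) (auto simp: inj_on_def n nth)
    also have "\<dots> = (\<Sum>i \<in> ?I. to_ac (fls_nth f i * fls_nth g (n - i)))"
      by (rule sum.mono_neutral_left) auto
    also have "\<dots> = to_ac (fls_nth (f * g) n)"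
      by (simp add: fls_times_nth(2) to_ac_sum)
    finally show ?thesis by (simp add: n nth)
  qed
qed


section \<open>Algebraic elements and their degree\<close>

text \<open>The extension is given by a field embedding \<open>h\<close>; \<open>P\<close> ranges over polynomials with
  coefficients in the base field.\<close>

definition algebraic_over :: "('f::field \<Rightarrow> 'r::idom) \<Rightarrow> 'r \<Rightarrow> bool"
  where "algebraic_over h x \<longleftrightarrow> (\<exists>P :: 'f poly. P \<noteq> 0 \<and> poly (map_poly h P) x = 0)"

definition is_min_poly_over :: "('f::field \<Rightarrow> 'r::idom) \<Rightarrow> 'r \<Rightarrow> 'f poly \<Rightarrow> bool"
  where "is_min_poly_over h x P \<longleftrightarrow>
    lead_coeff P = 1 \<and> poly (map_poly h P) x = 0 \<and>
    (\<forall>Q. Q \<noteq> 0 \<and> poly (map_poly h Q) x = 0 \<longrightarrow> degree P \<le> degree Q)"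

definition min_poly_over :: "('f::field \<Rightarrow> 'r::idom) \<Rightarrow> 'r \<Rightarrow> 'f poly"
  where "min_poly_over h x = (THE P. is_min_poly_over h x P)"

definition degree_over :: "('f::field \<Rightarrow> 'r::idom) \<Rightarrow> 'r \<Rightarrow> nat"
  where "degree_over h x = degree (min_poly_over h x)"

lemma is_min_poly_over_ex1:
  fixes h :: "'f::field \<Rightarrow> 'r::idom"
  assumes h: "h 0 = 0" "\<And>a b. h (a + b) = h a + h b" "\<And>a b. h (a * b) = h a * h b"
    and alg: "algebraic_over h x"
  shows "\<exists>!P. is_min_poly_over h x P"
proof -
  let ?root = "\<lambda>P. poly (map_poly h P) x = 0"
  have hsm: "map_poly h (smult c P) = smult (h c) (map_poly h P)" for c P
    by (rule poly_eqI) (simp add: coeff_map_poly h)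
  have hadd: "map_poly h (P + Q) = map_poly h P + map_poly h Q" for P Q
    by (rule poly_eqI) (simp add: coeff_map_poly h)
  have root_sm: "?root (smult c P)" if "?root P" for c P
    using that by (simp add: hsm)
  have root_diff: "?root (P - Q)" if "?root P" "?root Q" for P Q
    using that root_sm[of Q "-1"] hadd[of P "- Q"] by simp
  obtain P where P: "P \<noteq> 0" "?root P" "\<And>Q. Q \<noteq> 0 \<Longrightarrow> ?root Q \<Longrightarrow> degree P \<le> degree Q"
    using alg ex_has_least_nat[of "\<lambda>P. P \<noteq> 0 \<and> ?root P" _ degree]
    unfolding algebraic_over_def by blast
  have "is_min_poly_over h x (smult (inverse (lead_coeff P)) P)"
    unfolding is_min_poly_over_def using P root_sm by simp
  moreover have "A = B" if A: "is_min_poly_over h x A" and B: "is_min_poly_over h x B" for A B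
  proof (rule ccontr)
    assume ne: "A \<noteq> B"
    have "A \<noteq> 0" "B \<noteq> 0" using A B by (auto simp: is_min_poly_over_def)
    then have deg: "degree A = degree B"
      using A B unfolding is_min_poly_over_def by (meson le_antisym)
    have "degree A \<le> degree (A - B)"
      using A B ne root_diff unfolding is_min_poly_over_def by simp
    then have "degree (A - B) = degree A"
      using degree_diff_le_max[of A B] deg by simp
    moreover have "coeff (A - B) (degree A) = 0"
      using A B deg by (simp add: is_min_poly_over_def)
    ultimately have "A - B = 0"
      by (metis leading_coeff_0_iff)
    with ne show False by simp
  qed
  ultimately show ?thesis by blast
qed

lemma is_min_poly_over_laurent_ex1:
  "algebraic_over laurent_emb x \<Longrightarrow> \<exists>!P. is_min_poly_over laurent_emb x P"
  by (rule is_min_poly_over_ex1) (simp_all add: laurent_emb_add laurent_emb_mult)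


section \<open>Finite powers of the ordinal \<open>\<omega>\<close>\<close>

text \<open>The recursion \<open>\<omega>\<^sup>0 = 1\<close>, \<open>\<omega>\<^sup>k\<^sup>+\<^sup>1 = \<omega>\<^sup>k \<cdot> \<omega>\<close>, with the ordinal product
  \<open>\<alpha> \<cdot> \<beta>\<close> realised as \<open>\<beta>\<close> copies of \<open>\<alpha>\<close>: the entry \<open>i\<close> says in which of the \<open>\<omega>\<close> copies of
  \<open>\<omega>\<^sup>k\<close> the point \<open>xs\<close> lies.\<close>

fun omega_pow :: "nat \<Rightarrow> nat list rel"
  where
    "omega_pow 0 = {([], [])}"
  | "omega_pow (Suc k) = {(i # xs, j # ys) |i xs j ys.
       xs \<in> Field (omega_pow k) \<and> ys \<in> Field (omega_pow k) \<and>
       (i < j \<or> i = j \<and> (xs, ys) \<in> omega_pow k)}"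

lemma Field_omega_pow: "Field (omega_pow m) = {xs. length xs = m}"
proof (induction m)
  case (Suc k)
  have "(xs, xs) \<in> omega_pow k" if "length xs = k" for xs
    using that
  proof (induction k arbitrary: xs)
    case (Suc k)
    then obtain i ys where "xs = i # ys" "length ys = k" by (cases xs) auto
    moreover from this Suc.IH have "(ys, ys) \<in> omega_pow k" by blast
    ultimately show ?case by (auto simp: Field_def)
  qed auto
  note refl = this
  show ?case
  proof (intro equalityI subsetI)
    fix zs assume "zs \<in> Field (omega_pow (Suc k))"
    then show "zs \<in> {xs. length xs = Suc k}" unfolding omega_pow.simps Suc.IH by (auto simp: Field_def)
  next
    fix zs :: "nat list" assume "zs \<in> {xs. length xs = Suc k}"
    then obtain i ys where "zs = i # ys" "length ys = k" by (cases zs) auto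
    then have "(zs, zs) \<in> omega_pow (Suc k)" using refl Suc.IH by auto
    then show "zs \<in> Field (omega_pow (Suc k))" by (rule FieldI1)
  qed
qed (auto simp: Field_def)

lemma omega_pow_eq:
  "omega_pow m = {(xs, ys). length xs = m \<and> length ys = m \<and> (xs = ys \<or> (xs, ys) \<in> lexn less_than m)}"
proof (induction m)
  case (Suc k)
  have lexn: "(i # xs, j # ys) \<in> lexn less_than (Suc k) \<longleftrightarrow>
      length xs = k \<and> length ys = k \<and> (i < j \<or> i = j \<and> (xs, ys) \<in> lexn less_than k)" for i j xs ys
    using lexn_length[of xs ys less_than k] by (auto simp: image_iff Bex_def split_paired_Ex)
  have "(us, vs) \<in> omega_pow (Suc k) \<longleftrightarrow>
      (us, vs) \<in> {(xs, ys). length xs = Suc k \<and> length ys = Suc k \<and>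
                     (xs = ys \<or> (xs, ys) \<in> lexn less_than (Suc k))}" for us vs
    unfolding omega_pow.simps Field_omega_pow unfolding Suc.IH
    using lexn by (cases us; cases vs) (auto simp del: lexn.simps)
  then show ?case
    by (simp only: set_eq_iff split_paired_All simp_thms)
qed auto

lemma Well_order_omega_pow: "Well_order (omega_pow m)"
proof -
  have wf: "wf (lexn less_than m)" by (simp add: wf_lexn)
  have "(xs, ys) \<in> omega_pow m \<or> (ys, xs) \<in> omega_pow m" if "length xs = m" "length ys = m" for xs ys
    using that
  proof (induction m arbitrary: xs ys)
    case (Suc k)
    then obtain i us j vs where "xs = i # us" "ys = j # vs" "length us = k" "length vs = k"
      by (cases xs; cases ys) auto
    with Suc.IH[of us vs] show ?case
      by (auto simp: Field_omega_pow)
  qed auto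
  then have tot: "total_on {xs. length xs = m} (omega_pow m)"
    by (auto simp: total_on_def)
  have irr: "(xs, xs) \<notin> lexn less_than m" for xs
    using wf by (meson wf_not_refl)
  have tr: "trans (lexn less_than m)" by (simp add: lexn_transI)
  have "trans (omega_pow m)"
    using tr unfolding omega_pow_eq trans_def by blast
  moreover have "antisym (omega_pow m)"
    using tr irr unfolding omega_pow_eq antisym_def trans_def by blast
  moreover have "omega_pow m - Id = lexn less_than m"
    using irr lexn_length unfolding omega_pow_eq by blast
  ultimately show ?thesis
    using tot wf
    unfolding well_order_on_def linear_order_on_def partial_order_on_def preorder_on_def Field_omega_pow
    by (auto simp: refl_on_def omega_pow_eq)
qed

end

theory Submission
  imports Defs
begin

text \<open>
  The idea is to linearise the algebraic equation with the help of Frobenius and to follow how the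
  set of accumulation points of the support grows while the linearised equation is solved.

  If \<open>x\<close> has degree \<open>n\<close>, the \<open>n + 1\<close> elements \<open>x, x\<^sup>p, \<dots>\<close> with exponents \<open>p ^ i\<close>, \<open>i \<le> n\<close>, lie in
  an \<open>n\<close>-dimensional space, so \<open>x\<close> is a zero of an additive polynomial \<open>\<Sum>i\<le>d. a i * X ^ (p ^ i)\<close>
  with \<open>d \<le> n\<close> (\<open>powers_dependent\<close>). Its coefficients are Laurent series. These belong to the ring
  of series with left-finite support (only finitely many exponents below any bound), which is
  more convenient as a base: over an algebraically closed coefficient field of characteristic \<open>p\<close>
  it is a field (\<open>left_finite_inverse\<close>), and every additive polynomial over it of degree
  \<open>p ^ d\<close>, \<open>d > 0\<close>, with nonzero linear term has a nonzero root in it (\<open>additive_root\<close>). Indeed, a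
  root of largest possible valuation can be computed by a Newton iteration, since above that
  valuation the linear term dominates; and each iteration improves the approximation by a
  fixed amount, so the exponents cannot accumulate (\<open>hahn_contraction_fixpoint\<close>).

  Given such a root \<open>u\<close>, write \<open>x = u * z\<close>. The equation for \<open>z\<close> has coefficient sum \<open>0\<close>, and
  summation by parts turns it into an additive equation with one term less for the
  Artin-Schreier expression \<open>z ^ p - z\<close>. So \<open>x\<close> is obtained by solving \<open>d\<close> successive Artin-Schreier
  equations \<open>z ^ p - z = w\<close>, up to multiplications by left-finite series and passages to
  \<open>p\<close>-th roots (\<open>depth_le_if_additive_equation\<close>). In such an equation every exponent of \<open>z\<close> other
  than \<open>0\<close> is a negative exponent of \<open>w\<close> divided by a power of \<open>p\<close> or a positive one multiplied by a
  power of \<open>p\<close>. The first kind creates a new accumulation point at \<open>0\<close> only, and the second kind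
  creates none (\<open>locally_shallow_frobenius_orbits\<close>).

  The predicate \<open>depth_le k x\<close> records that accumulation points in the support of \<open>x\<close> are nested at
  most \<open>k\<close> deep. Left-finite means \<open>k = 0\<close>, each Artin-Schreier equation raises \<open>k\<close> by one, and
  depth at most \<open>k\<close> forces order type at most \<open>\<omega>\<^sup>k\<^sup>+\<^sup>1\<close> (\<open>locally_shallow_ordLeq\<close>). Altogether the support
  of \<open>x\<close> has order type at most \<open>\<omega>\<^sup>n\<^sup>+\<^sup>1\<close>, and \<open>n + 1 \<le> n * (n + 1) div 2 + 1\<close> because \<open>n \<ge> 1\<close>.
\<close>

section \<open>Comparing order types\<close>

declare omega_pow.simps [simp del]

text \<open>The image of a least point that is moved downwards would again be moved downwards.\<close>

lemma strict_self_map_not_descending: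
  assumes "Well_order r"
    and "\<And>a. a \<in> Field r \<Longrightarrow> h a \<in> Field r"
    and "\<And>a b. (a, b) \<in> r - Id \<Longrightarrow> (h a, h b) \<in> r - Id"
    and "a \<in> Field r"
  shows "(h a, a) \<notin> r - Id"
proof -
  have "wf (r - Id)" using assms(1) by (simp add: well_order_on_def)
  then show ?thesis
    using assms(4)
  proof (induction a rule: wf_induct_rule)
    case (less a)
    then show ?case using assms(2,3) by blast
  qed
qed

text \<open>If \<open>r'\<close> were smaller, it would be isomorphic to a proper initial segment of \<open>r\<close>; composing
  with \<open>f\<close> would map \<open>r\<close> strictly monotonically into itself and move some point downwards.\<close>

lemma ordLeq_if_strict_map:
  assumes r: "Well_order r" and r': "Well_order r'"
    and f: "\<And>a. a \<in> Field r \<Longrightarrow> f a \<in> Field r'"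
    and mono: "\<And>a b. (a, b) \<in> r - Id \<Longrightarrow> (f a, f b) \<in> r' - Id"
  shows "(r, r') \<in> ordLeq"
proof (rule ccontr)
  assume "(r, r') \<notin> ordLeq"
  then have "(r', r) \<in> ordLess"
    using r r' not_ordLeq_iff_ordLess by blast
  then obtain g where g: "embedS r' r g" by (auto simp: ordLess_def)
  then have emb: "embed r' r g" by (simp add: embedS_def)
  have inj: "inj_on g (Field r')" using embed_inj_on[OF r' emb] .
  have comp: "(g u, g v) \<in> r" if "(u, v) \<in> r'" for u v
    using embed_compat[OF emb] that by (auto simp: compat_def)
  have gF: "g ` Field r' \<subset> Field r" using embedS_Field[OF r' g] .
  then obtain s where s: "s \<in> Field r" "s \<notin> g ` Field r'" by blast
  interpret wo_rel r using r by (simp add: wo_rel_def)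
  have filt: "ofilter (g ` Field r')"
    using embed_Field_ofilter[OF r' r emb] .
  have below: "(g v, s) \<in> r - Id" if v: "v \<in> Field r'" for v
  proof -
    have gv: "g v \<in> Field r" "g v \<in> g ` Field r'" using v gF by auto
    have "(s, g v) \<notin> r" using filt gv s unfolding ofilter_def under_def by blast
    moreover have "(g v, s) \<in> r \<or> (s, g v) \<in> r"
      using gv(1) s(1) TOTALS by blast
    ultimately show ?thesis using gv s by blast
  qed
  have "(g (f s), s) \<notin> r - Id"
  proof (rule strict_self_map_not_descending[OF r])
    show "g (f a) \<in> Field r" if "a \<in> Field r" for a
      using f[OF that] gF by blast
    show "(g (f a), g (f b)) \<in> r - Id" if ab: "(a, b) \<in> r - Id" for a b
    proof -
      have "a \<in> Field r" "b \<in> Field r" using ab by (auto simp: Field_def)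
      then have "g (f a) \<noteq> g (f b)"
        using mono[OF ab] inj_onD[OF inj, of "f a" "f b"] f by blast
      then show ?thesis using comp mono[OF ab] by blast
    qed
  qed (rule s(1))
  then show False using below f s(1) by blast
qed

lemma Field_le_on [simp]: "Field (le_on S) = S"
  by (auto simp: Field_def le_on_def)

lemma Well_order_le_on: "well_ordered S \<Longrightarrow> Well_order (le_on S)"
  by (simp add: well_ordered_def)

lemma omega_pow_minus_Id: "omega_pow m - Id = lexn less_than m"
proof -
  have "(xs, xs) \<notin> lexn less_than m" for xs
    using wf_lexn[OF wf_less_than] by (rule wf_not_refl)
  then show ?thesis
    using lexn_length unfolding omega_pow_eq by blast
qed

text \<open>This expresses that an order type is the least upper bound of the successors of its
  proper initial segments. It replaces all computations with suprema of ordinals below.\<close>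

lemma ordLeq_if_initial_segments_ordLess:
  assumes S: "well_ordered S" and r: "Well_order r"
    and seg: "\<And>s. s \<in> S \<Longrightarrow> (le_on (S \<inter> {..<s}), r) \<in> ordLess"
  shows "(le_on S, r) \<in> ordLeq"
proof (rule ccontr)
  assume "(le_on S, r) \<notin> ordLeq"
  then have "(r, le_on S) \<in> ordLess"
    using r S Well_order_le_on not_ordLeq_iff_ordLess by blast
  then obtain g where g: "embedS r (le_on S) g" by (auto simp: ordLess_def)
  then have emb: "embed r (le_on S) g" by (simp add: embedS_def)
  have inj: "inj_on g (Field r)" using embed_inj_on[OF r emb] .
  have comp: "(g u, g v) \<in> le_on S" if "(u, v) \<in> r" for u v
    using embed_compat[OF emb] that by (auto simp: compat_def)
  have gF: "g ` Field r \<subset> S" using embedS_Field[OF r g] by simp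
  then obtain s where s: "s \<in> S" "s \<notin> g ` Field r" by blast
  have filt: "wo_rel.ofilter (le_on S) (g ` Field r)"
    using embed_Field_ofilter[OF r Well_order_le_on[OF S] emb] .
  have below: "g v < s" if v: "v \<in> Field r" for v
  proof (rule ccontr)
    assume "\<not> g v < s"
    then have "(s, g v) \<in> le_on S" using v s gF by (auto simp: le_on_def)
    then have "s \<in> g ` Field r"
      using filt v wo_rel.ofilter_def[of "le_on S"] Well_order_le_on[OF S]
      unfolding under_def wo_rel_def by blast
    then show False using s by simp
  qed
  have "(r, le_on (S \<inter> {..<s})) \<in> ordLeq"
  proof (rule ordLeq_if_strict_map[OF r])
    show "Well_order (le_on (S \<inter> {..<s}))"
      using well_ordered_subset[OF S] by (intro Well_order_le_on) simp
    show "g a \<in> Field (le_on (S \<inter> {..<s}))" if "a \<in> Field r" for a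
      using that gF below by auto
    show "(g a, g b) \<in> le_on (S \<inter> {..<s}) - Id" if ab: "(a, b) \<in> r - Id" for a b
    proof -
      have F: "a \<in> Field r" "b \<in> Field r" using ab by (auto simp: Field_def)
      then have "g a \<noteq> g b" using ab inj_onD[OF inj, of a b] by blast
      moreover have "(g a, g b) \<in> le_on S" using comp ab by blast
      ultimately show ?thesis using below F by (auto simp: le_on_def)
    qed
  qed
  then show False using seg[OF s(1)] not_ordLess_ordLeq by blast
qed

lemma strict_map_if_ordLeq:
  assumes S: "well_ordered S" and le: "(le_on S, omega_pow m) \<in> ordLeq"
  obtains f where "\<And>s. s \<in> S \<Longrightarrow> length (f s) = m"
    and "\<And>s t. s \<in> S \<Longrightarrow> t \<in> S \<Longrightarrow> s < t \<Longrightarrow> (f s, f t) \<in> lexn less_than m"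
proof -
  obtain f where f: "embed (le_on S) (omega_pow m) f"
    using le by (auto simp: ordLeq_def)
  have inj: "inj_on f S" using embed_inj_on[OF Well_order_le_on[OF S] f] by simp
  show thesis
  proof (rule that)
    show "length (f s) = m" if "s \<in> S" for s
      using embed_Field[OF f] that by (auto simp: Field_omega_pow)
    show "(f s, f t) \<in> lexn less_than m" if st: "s \<in> S" "t \<in> S" "s < t" for s t
    proof -
      have "(s, t) \<in> le_on S" using st by (simp add: le_on_def)
      then have "(f s, f t) \<in> omega_pow m"
        using embed_compat[OF f] by (auto simp: compat_def)
      moreover have "f s \<noteq> f t" using inj_onD[OF inj, of s t] st by auto
      ultimately show ?thesis
        unfolding omega_pow_minus_Id[symmetric] by simp
    qed
  qed
qed

text \<open>The map \<open>s \<mapsto> i s # f s\<close> stays below the point \<open>c # [0, \<dots>, 0]\<close>, that is, it embeds \<open>S\<close> into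
  the ordinal \<open>\<omega>\<^sup>m \<cdot> c\<close>, which is strictly smaller than \<open>\<omega>\<^sup>m\<^sup>+\<^sup>1\<close>.\<close>

lemma ordLess_if_strict_map_bounded:
  assumes S: "well_ordered S"
    and len: "\<And>s. s \<in> S \<Longrightarrow> length (f s) = m"
    and bd: "\<And>s. s \<in> S \<Longrightarrow> i s < (c::nat)"
    and mono: "\<And>s t. s \<in> S \<Longrightarrow> t \<in> S \<Longrightarrow> s < t \<Longrightarrow>
       i s < i t \<or> i s = i t \<and> (f s, f t) \<in> lexn less_than m"
  shows "(le_on S, omega_pow (Suc m)) \<in> ordLess"
proof (rule ccontr)
  let ?r = "omega_pow (Suc m)" and ?h = "\<lambda>s. i s # f s"
  have Id: "(u # us, v # vs) \<in> ?r - Id \<longleftrightarrow> length us = m \<and> length vs = m \<and>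
      (u < v \<or> u = v \<and> (us, vs) \<in> lexn less_than m)" for u v us vs
    using lexn_length[of us vs less_than m] unfolding omega_pow_minus_Id
    by (auto simp: image_iff Bex_def split_paired_Ex)
  assume "(le_on S, ?r) \<notin> ordLess"
  then have "(?r, le_on S) \<in> ordLeq"
    using S Well_order_le_on Well_order_omega_pow not_ordLess_iff_ordLeq by blast
  then obtain g where g: "embed ?r (le_on S) g" by (auto simp: ordLeq_def)
  have inj: "inj_on g (Field ?r)" using embed_inj_on[OF Well_order_omega_pow g] .
  have gS: "g w \<in> S" if "w \<in> Field ?r" for w
    using embed_in_Field[OF g that] by simp
  have "(?h (g (c # replicate m 0)), c # replicate m 0) \<notin> ?r - Id"
  proof (rule strict_self_map_not_descending[OF Well_order_omega_pow])
    show "?h (g w) \<in> Field ?r" if "w \<in> Field ?r" for w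
      using gS[OF that] len by (simp add: Field_omega_pow)
    show "(?h (g v), ?h (g w)) \<in> ?r - Id" if vw: "(v, w) \<in> ?r - Id" for v w
    proof -
      have F: "v \<in> Field ?r" "w \<in> Field ?r" using vw by (auto intro: FieldI1 FieldI2)
      have "g v \<noteq> g w" using vw F inj_onD[OF inj, of v w] by blast
      moreover have "(g v, g w) \<in> le_on S"
        using embed_compat[OF g] vw by (auto simp: compat_def)
      ultimately have "g v < g w" by (auto simp: le_on_def)
      then show ?thesis
        unfolding Id using mono gS[OF F(1)] gS[OF F(2)] len by blast
    qed
    show "c # replicate m 0 \<in> Field ?r" by (simp add: Field_omega_pow)
  qed
  moreover have "c # replicate m 0 \<in> Field ?r" by (simp add: Field_omega_pow)
  ultimately show False
    unfolding Id using gS bd len by auto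
qed

section \<open>Sets of bounded accumulation depth\<close>

text \<open>After removing finitely many cut points, a set of depth \<open>k + 1\<close> is locally of depth \<open>k\<close>. The
  intervals \<open>{a..<b}\<close> may start at a cut point but have to end strictly before the next one,
  since in a well-ordered set points accumulate only from the left. Cutting by finite sets, instead
  of decomposing into finitely many pieces, makes closure under unions immediate.\<close>

fun shallow :: "nat \<Rightarrow> rat set \<Rightarrow> bool" where
  "shallow 0 S \<longleftrightarrow> finite S"
| "shallow (Suc k) S \<longleftrightarrow>
     (\<exists>P. finite P \<and> (\<forall>a b. P \<inter> {a<..b} = {} \<longrightarrow> shallow k (S \<inter> {a..<b})))"

text \<open>The finitely many cut points split \<open>S\<close> into finitely many consecutive blocks. A proper initial
  segment of a block avoids the cut points, so by induction a block has type at most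
  \<open>\<omega>\<^sup>k\<^sup>+\<^sup>1\<close>, and \<open>c\<close> such blocks have type at most \<open>\<omega>\<^sup>k\<^sup>+\<^sup>1 \<cdot> c < \<omega>\<^sup>k\<^sup>+\<^sup>2\<close>.\<close>

lemma shallow_ordLess:
  "shallow k S \<Longrightarrow> well_ordered S \<Longrightarrow> (le_on S, omega_pow (Suc k)) \<in> ordLess"
proof (induction k arbitrary: S)
  case 0
  then have fin: "finite S" by simp
  show ?case
  proof (rule ordLess_if_strict_map_bounded[OF 0(2), where f = "\<lambda>_. []"])
    fix s assume "s \<in> S"
    show "card {t \<in> S. t < s} < Suc (card S)"
      using fin by (simp add: card_mono less_Suc_eq_le)
  next
    fix s t assume "s \<in> S" "t \<in> S" "s < t"
    then have "{u \<in> S. u < s} \<subset> {u \<in> S. u < t}" by auto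
    then show "card {u \<in> S. u < s} < card {u \<in> S. u < t} \<or>
       card {u \<in> S. u < s} = card {u \<in> S. u < t} \<and> ([], []) \<in> lexn less_than 0"
      using fin by (simp add: psubset_card_mono)
  qed simp
next
  case (Suc k)
  obtain P where P: "finite P" "\<And>a b. P \<inter> {a<..b} = {} \<Longrightarrow> shallow k (S \<inter> {a..<b})"
    using Suc.prems(1) by auto
  \<comment> \<open>the number of the block that contains \<open>x\<close>\<close>
  define i where "i = (\<lambda>x. card {p \<in> P. p \<le> x})"
  define T where "T = (\<lambda>j. {x \<in> S. i x = j})"
  have T: "well_ordered (T j)" for j
    using well_ordered_subset[OF Suc.prems(2)] by (simp add: T_def)
  have i_mono: "i x \<le> i y" if "x \<le> y" for x y
    unfolding i_def by (rule card_mono) (use P(1) that in auto)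
  have i_eq: "P \<inter> {x<..y} = {}" if "x \<le> y" "i x = i y" for x y
  proof -
    have "{p \<in> P. p \<le> x} = {p \<in> P. p \<le> y}"
      by (rule card_subset_eq) (use P(1) that in \<open>auto simp: i_def\<close>)
    moreover have "p \<le> x" if "p \<in> P" "p \<le> y" for p
      using calculation that by blast
    ultimately show ?thesis by fastforce
  qed
  have "(le_on (T j), omega_pow (Suc k)) \<in> ordLeq" for j
  proof (rule ordLeq_if_initial_segments_ordLess[OF T Well_order_omega_pow])
    fix s assume s: "s \<in> T j"
    then obtain a where a: "a \<in> T j" "\<And>t. t \<in> T j \<Longrightarrow> a \<le> t"
      using well_ordered_least[OF T, of j] by blast
    have "shallow k (S \<inter> {a..<s} \<inter> T j)"
    proof -
      have "shallow k (S \<inter> {a..<s})"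
        by (rule P(2), rule i_eq) (use a s in \<open>auto simp: T_def\<close>)
      moreover have "S \<inter> {a..<s} \<inter> T j = S \<inter> {a..<s}"
      proof -
        have "i x = j" if "a \<le> x" "x < s" for x
          using i_mono[of a x] i_mono[of x s] that a s by (simp add: T_def)
        then show ?thesis by (auto simp: T_def)
      qed
      ultimately show ?thesis by simp
    qed
    moreover have "S \<inter> {a..<s} \<inter> T j = T j \<inter> {..<s}"
      using a by (auto simp: T_def)
    ultimately have "shallow k (T j \<inter> {..<s})" by simp
    then show "(le_on (T j \<inter> {..<s}), omega_pow (Suc k)) \<in> ordLess"
      by (rule Suc.IH) (rule well_ordered_subset[OF T], blast)
  qed
  then have "\<forall>j. \<exists>f. (\<forall>s\<in>T j. length (f s) = Suc k) \<and>
      (\<forall>s\<in>T j. \<forall>t\<in>T j. s < t \<longrightarrow> (f s, f t) \<in> lexn less_than (Suc k))"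
    using strict_map_if_ordLeq[OF T] by metis
  then obtain f where f: "\<And>j s. s \<in> T j \<Longrightarrow> length (f j s) = Suc k"
    "\<And>j s t. s \<in> T j \<Longrightarrow> t \<in> T j \<Longrightarrow> s < t \<Longrightarrow> (f j s, f j t) \<in> lexn less_than (Suc k)"
    by metis
  show ?case
  proof (rule ordLess_if_strict_map_bounded[OF Suc.prems(2),
        where i = i and f = "\<lambda>s. f (i s) s" and c = "Suc (card P)"])
    fix s assume s: "s \<in> S"
    then show "length (f (i s) s) = Suc k" by (intro f) (simp add: T_def)
    show "i s < Suc (card P)"
      unfolding i_def using P(1) by (simp add: card_mono less_Suc_eq_le)
  next
    fix s t assume st: "s \<in> S" "t \<in> S" "s < t"
    show "i s < i t \<or> i s = i t \<and> (f (i s) s, f (i t) t) \<in> lexn less_than (Suc k)"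
    proof (cases "i s = i t")
      case True
      then show ?thesis using f(2)[of s "i t" t] st by (simp add: T_def)
    next
      case False
      then show ?thesis using i_mono[of s t] st by simp
    qed
  qed
qed

lemma shallow_subset: "shallow k S \<Longrightarrow> T \<subseteq> S \<Longrightarrow> shallow k T"
proof (induction k arbitrary: S T)
  case 0
  then show ?case by (auto intro: finite_subset)
next
  case (Suc k)
  obtain P where P: "finite P" "\<And>a b. P \<inter> {a<..b} = {} \<Longrightarrow> shallow k (S \<inter> {a..<b})"
    using Suc.prems(1) by auto
  have "shallow k (T \<inter> {a..<b})" if "P \<inter> {a<..b} = {}" for a b
    using Suc.IH[OF P(2)[OF that], of "T \<inter> {a..<b}"] Suc.prems(2) by blast
  then show ?case using P(1) by auto
qed

lemma shallow_empty [simp]: "shallow k {}"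
  by (induction k) auto

lemma shallow_Un: "shallow k S \<Longrightarrow> shallow k T \<Longrightarrow> shallow k (S \<union> T)"
proof (induction k arbitrary: S T)
  case (Suc k)
  obtain P where P: "finite P" "\<And>a b. P \<inter> {a<..b} = {} \<Longrightarrow> shallow k (S \<inter> {a..<b})"
    using Suc.prems(1) by auto
  obtain Q where Q: "finite Q" "\<And>a b. Q \<inter> {a<..b} = {} \<Longrightarrow> shallow k (T \<inter> {a..<b})"
    using Suc.prems(2) by auto
  have "shallow k ((S \<union> T) \<inter> {a..<b})" if "(P \<union> Q) \<inter> {a<..b} = {}" for a b
    using Suc.IH[OF P(2) Q(2), of a b a b] that by (simp add: Int_Un_distrib2 Un_empty)
  then show ?case using P(1) Q(1) by (auto intro!: exI[of _ "P \<union> Q"])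
qed simp

lemma shallow_UN: "finite I \<Longrightarrow> (\<And>i. i \<in> I \<Longrightarrow> shallow k (A i)) \<Longrightarrow> shallow k (\<Union>i\<in>I. A i)"
  by (induction I rule: finite_induct) (auto intro: shallow_Un)

lemma shallow_Suc: "shallow k S \<Longrightarrow> shallow (Suc k) S"
  by (auto intro!: exI[of _ "{}"] intro: shallow_subset)

lemma shallow_mono: "shallow k S \<Longrightarrow> k \<le> l \<Longrightarrow> shallow l S"
  by (induction l) (auto simp: le_Suc_eq simp del: shallow.simps intro: shallow_Suc)

lemma shallow_affine_image:
  fixes c d :: rat
  assumes "c > 0"
  shows "shallow k S \<Longrightarrow> shallow k ((\<lambda>x. c * x + d) ` S)"
proof (induction k arbitrary: S)
  case (Suc k)
  obtain P where P: "finite P" "\<And>a b. P \<inter> {a<..b} = {} \<Longrightarrow> shallow k (S \<inter> {a..<b})"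
    using Suc.prems(1) by auto
  let ?h = "\<lambda>x. c * x + d" and ?g = "\<lambda>y. (y - d) / c"
  have "shallow k (?h ` S \<inter> {a..<b})" if ab: "?h ` P \<inter> {a<..b} = {}" for a b
  proof -
    have "P \<inter> {?g a<..?g b} = {}"
      using ab assms by (force simp: field_simps)
    then have "shallow k (?h ` (S \<inter> {?g a..<?g b}))"
      by (intro Suc.IH P(2))
    moreover have "?h ` S \<inter> {a..<b} = ?h ` (S \<inter> {?g a..<?g b})"
      using assms by (force simp: field_simps)
    ultimately show ?thesis by simp
  qed
  then show ?case using P(1) by (auto intro!: exI[of _ "?h ` P"])
qed simp

text \<open>For \<open>k = 0\<close> these are the left-finite sets.\<close>

definition locally_shallow :: "nat \<Rightarrow> rat set \<Rightarrow> bool"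
  where "locally_shallow k S \<longleftrightarrow> (\<exists>m. \<forall>s\<in>S. m \<le> s) \<and> (\<forall>B. shallow k (S \<inter> {..<B}))"

lemma locally_shallow_ordLeq:
  assumes "locally_shallow k S" "well_ordered S"
  shows "(le_on S, omega_pow (Suc k)) \<in> ordLeq"
proof (rule ordLeq_if_initial_segments_ordLess[OF assms(2) Well_order_omega_pow])
  fix s assume "s \<in> S"
  show "(le_on (S \<inter> {..<s}), omega_pow (Suc k)) \<in> ordLess"
    using assms by (intro shallow_ordLess) (auto simp: locally_shallow_def intro: well_ordered_subset)
qed

lemma locally_shallow_subset: "locally_shallow k S \<Longrightarrow> T \<subseteq> S \<Longrightarrow> locally_shallow k T"
  unfolding locally_shallow_def by (meson Int_mono order_refl shallow_subset subsetD)

lemma locally_shallow_Un: 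
  assumes "locally_shallow k S" "locally_shallow k T" shows "locally_shallow k (S \<union> T)"
proof -
  obtain m m' where "\<forall>s\<in>S. m \<le> s" "\<forall>s\<in>T. m' \<le> s" using assms by (auto simp: locally_shallow_def)
  then have "\<forall>s\<in>S \<union> T. min m m' \<le> s" by (auto simp: min_le_iff_disj)
  moreover have "shallow k ((S \<union> T) \<inter> {..<B})" for B
    using assms by (simp add: locally_shallow_def Int_Un_distrib2 shallow_Un)
  ultimately show ?thesis unfolding locally_shallow_def by blast
qed

lemma locally_shallow_mono: "locally_shallow k S \<Longrightarrow> k \<le> l \<Longrightarrow> locally_shallow l S"
  unfolding locally_shallow_def using shallow_mono by blast

lemma locally_shallow_scale:
  fixes c :: rat
  assumes "c > 0" "locally_shallow k S"
  shows "locally_shallow k ((\<lambda>x. c * x) ` S)"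
proof -
  obtain m where "\<forall>s\<in>S. m \<le> s" using assms by (auto simp: locally_shallow_def)
  then have "\<forall>s\<in>(\<lambda>x. c * x) ` S. c * m \<le> s" using assms(1) by auto
  moreover have "shallow k ((\<lambda>x. c * x) ` S \<inter> {..<B})" for B
  proof -
    have "(\<lambda>x. c * x) ` S \<inter> {..<B} = (\<lambda>x. c * x + 0) ` (S \<inter> {..<B / c})"
      using assms(1) by (force simp: field_simps)
    then show ?thesis
      using shallow_affine_image[OF assms(1), of k "S \<inter> {..<B / c}" 0] assms(2) by (simp add: locally_shallow_def)
  qed
  ultimately show ?thesis unfolding locally_shallow_def by blast
qed

text \<open>Below a given bound, only finitely many elements of the left-finite set \<open>T\<close> contribute, so
  the sumset is a finite union of translates of \<open>S\<close> there.\<close>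

lemma locally_shallow_sums:
  assumes "locally_shallow 0 T" "locally_shallow k S"
  shows "locally_shallow k {a + b |a b. a \<in> T \<and> b \<in> S}"
proof -
  obtain m m' where m: "\<forall>s\<in>S. m \<le> s" "\<forall>s\<in>T. m' \<le> s" using assms by (auto simp: locally_shallow_def)
  have "shallow k ({a + b |a b. a \<in> T \<and> b \<in> S} \<inter> {..<B})" for B
  proof (rule shallow_subset)
    show "shallow k (\<Union>t \<in> T \<inter> {..<B - m}. (\<lambda>x. 1 * x + t) ` (S \<inter> {..<B - t}))"
      using assms by (intro shallow_UN shallow_affine_image) (auto simp: locally_shallow_def)
    show "{a + b |a b. a \<in> T \<and> b \<in> S} \<inter> {..<B} \<subseteq> (\<Union>t \<in> T \<inter> {..<B - m}. (\<lambda>x. 1 * x + t) ` (S \<inter> {..<B - t}))"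
    proof
      fix x assume "x \<in> {a + b |a b. a \<in> T \<and> b \<in> S} \<inter> {..<B}"
      then obtain a b where x: "x = a + b" "a \<in> T" "b \<in> S" "x < B" by auto
      then have "a < B - m" using m(1) by force
      moreover have "x = 1 * b + a" "b < B - a" using x by auto
      ultimately show "x \<in> (\<Union>t \<in> T \<inter> {..<B - m}. (\<lambda>x. 1 * x + t) ` (S \<inter> {..<B - t}))"
        using x by blast
    qed
  qed
  moreover have "\<forall>s\<in>{a + b |a b. a \<in> T \<and> b \<in> S}. m' + m \<le> s"
    using m by (auto intro: add_mono)
  ultimately show ?thesis unfolding locally_shallow_def by blast
qed

lemma finite_powers_less:
  fixes p :: nat and C :: rat
  assumes "p \<ge> 2"
  shows "finite {i::nat. of_nat p ^ i < C}"
proof -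
  obtain N :: nat where N: "C < of_nat N" using reals_Archimedean2 by blast
  have "i \<le> N" if "of_nat p ^ i < C" for i
  proof (rule ccontr)
    assume "\<not> i \<le> N"
    then have "N < p ^ i" using assms
      by (metis less_exp less_le_trans linear order.strict_trans1 power_mono zero_le not_le)
    then have "of_nat N < (of_nat p ^ i :: rat)" by (metis of_nat_less_iff of_nat_power)
    then show False using order.strict_trans[OF N] that by (meson not_less_iff_gr_or_eq)
  qed
  then show ?thesis by (auto intro: finite_subset[of _ "{..N}"])
qed

text \<open>Away from \<open>0\<close> only finitely many powers of \<open>p\<close> matter below a given bound: \<open>W\<close> is bounded
  below, and its positive elements are bounded away from \<open>0\<close>. So \<open>0\<close> is the one cut point
  that has to be added. The hypotheses \<open>orb\<close> are what \<open>z ^ p - z = w\<close> says about supports.\<close>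

lemma locally_shallow_frobenius_orbits:
  fixes p :: nat
  assumes p: "p \<ge> 2" and W: "locally_shallow k W" "well_ordered W"
    and Z: "\<exists>m. \<forall>z\<in>Z. m \<le> z"
    and orb: "\<And>z. z \<in> Z \<Longrightarrow> z < 0 \<Longrightarrow> \<exists>i. of_nat p ^ i * z \<in> W"
      "\<And>z. z \<in> Z \<Longrightarrow> z > 0 \<Longrightarrow> \<exists>i. z / of_nat p ^ i \<in> W"
  shows "locally_shallow (Suc k) Z"
proof -
  define q :: rat where "q = of_nat p"
  have q: "q > 1" using p by (simp add: q_def)
  then have qi: "q ^ i > 0" for i by simp
  obtain m where m: "\<forall>s\<in>W. m \<le> s" using W by (auto simp: locally_shallow_def)
  have "\<exists>w>0. \<forall>s\<in>W. s > 0 \<longrightarrow> w \<le> s"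
  proof (cases "W \<inter> {0<..} = {}")
    case True
    then show ?thesis by (auto intro!: exI[of _ 1])
  next
    case False
    then show ?thesis
      using well_ordered_least[OF well_ordered_subset[OF W(2)], of "W \<inter> {0<..}"]
      by (metis Int_iff Int_lower1 greaterThan_iff)
  qed
  then obtain w where w: "w > 0" "\<And>s. s \<in> W \<Longrightarrow> s > 0 \<Longrightarrow> w \<le> s" by blast
  have neg: "shallow k (Z \<inter> {..<b})" if b: "b < 0" for b
  proof (rule shallow_subset)
    show "shallow k (\<Union>i \<in> {i. of_nat p ^ i < m / b + 1}. (\<lambda>x. (1 / q ^ i) * x + 0) ` (W \<inter> {..<q ^ i * b}))"
      using W(1) qi finite_powers_less[OF p]
      by (intro shallow_UN shallow_affine_image) (auto simp: locally_shallow_def)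
    show "Z \<inter> {..<b} \<subseteq> (\<Union>i \<in> {i. of_nat p ^ i < m / b + 1}. (\<lambda>x. (1 / q ^ i) * x + 0) ` (W \<inter> {..<q ^ i * b}))"
    proof
      fix z assume z: "z \<in> Z \<inter> {..<b}"
      then obtain i where i: "q ^ i * z \<in> W" using orb(1)[of z] b by (auto simp: q_def)
      have lt: "q ^ i * z < q ^ i * b" using z qi by simp
      have "m \<le> q ^ i * z" using m i by blast
      then have "m < q ^ i * b" using lt by simp
      then have "q ^ i < m / b" using b by (simp add: field_simps)
      then have "of_nat p ^ i < m / b + 1" by (simp add: q_def)
      moreover have "z = (1 / q ^ i) * (q ^ i * z) + 0" using q by simp
      ultimately show "z \<in> (\<Union>i \<in> {i. of_nat p ^ i < m / b + 1}. (\<lambda>x. (1 / q ^ i) * x + 0) ` (W \<inter> {..<q ^ i * b}))"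
        using i lt by blast
    qed
  qed
  have pos: "shallow k (Z \<inter> {0<..<b})" for b
  proof (rule shallow_subset)
    show "shallow k (\<Union>i \<in> {i. of_nat p ^ i < b / w}. (\<lambda>x. q ^ i * x + 0) ` (W \<inter> {..<b / q ^ i}))"
      using W(1) qi finite_powers_less[OF p]
      by (intro shallow_UN shallow_affine_image) (auto simp: locally_shallow_def)
    show "Z \<inter> {0<..<b} \<subseteq> (\<Union>i \<in> {i. of_nat p ^ i < b / w}. (\<lambda>x. q ^ i * x + 0) ` (W \<inter> {..<b / q ^ i}))"
    proof
      fix z assume z: "z \<in> Z \<inter> {0<..<b}"
      then obtain i where i: "z / q ^ i \<in> W" using orb(2)[of z] by (auto simp: q_def)
      have lt: "z / q ^ i < b / q ^ i" using z qi by (simp add: divide_strict_right_mono)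
      have "w \<le> z / q ^ i" using w i z qi by simp
      then have "w < b / q ^ i" using lt by simp
      then have "of_nat p ^ i < b / w" using w qi[of i] by (simp add: q_def field_simps)
      moreover have "z = q ^ i * (z / q ^ i) + 0" using q by simp
      ultimately show "z \<in> (\<Union>i \<in> {i. of_nat p ^ i < b / w}. (\<lambda>x. q ^ i * x + 0) ` (W \<inter> {..<b / q ^ i}))"
        using i lt by blast
    qed
  qed
  have z0: "shallow k {0}" using shallow_mono[of 0 "{0}" k] by simp
  have "shallow (Suc k) (Z \<inter> {..<B})" for B
    unfolding shallow.simps
  proof (intro exI[of _ "{0}"] conjI allI impI)
    fix a b :: rat assume ab: "{0} \<inter> {a<..b} = {}"
    then consider "b < 0" | "a \<ge> 0" by fastforce
    then show "shallow k (Z \<inter> {..<B} \<inter> {a..<b})"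
    proof cases
      case 1
      then show ?thesis by (rule shallow_subset[OF neg]) auto
    next
      case 2
      then show ?thesis by (intro shallow_subset[OF shallow_Un[OF pos z0]]) auto
    qed
  qed simp
  then show ?thesis using Z by (simp add: locally_shallow_def del: shallow.simps)
qed

section \<open>Valuation, monomials and Frobenius on Hahn series\<close>

text \<open>In particular \<open>depth_le 0 x\<close> says that the support of \<open>x\<close> is left-finite.\<close>

abbreviation depth_le :: "nat \<Rightarrow> ('k::zero, rat) hahn \<Rightarrow> bool"
  where "depth_le k x \<equiv> locally_shallow k (hahn_supp x)"

lemmas hahn_nth_add [simp] = plus_hahn.rep_eq
lemmas hahn_nth_uminus [simp] = uminus_hahn.rep_eq
lemmas hahn_nth_0 [simp] = zero_hahn.rep_eq

lemma hahn_nth_diff [simp]: "hahn_nth (x - y) g = hahn_nth x g - hahn_nth y g"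
  unfolding minus_hahn_def hahn_nth_add hahn_nth_uminus by simp

lemma hahn_nth_sum: "hahn_nth (\<Sum>i\<in>I. f i) g = (\<Sum>i\<in>I. hahn_nth (f i) g)"
  by (induction I rule: infinite_finite_induct) auto

lemma depth_le_0 [simp]: "depth_le k (0 :: ('k::zero, rat) hahn)"
  by (simp add: locally_shallow_def hahn_supp_def)

lemma depth_le_1 [simp]: "depth_le k (1 :: ('k::zero_neq_one, rat) hahn)"
proof -
  have "hahn_supp (1 :: ('k, rat) hahn) = {0}"
    by (auto simp: hahn_supp_def one_hahn.rep_eq)
  moreover have "locally_shallow 0 {0}" unfolding locally_shallow_def by (intro conjI exI[of _ 0]) simp_all
  then have "locally_shallow k {0}" by (rule locally_shallow_mono) simp
  ultimately show ?thesis by simp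
qed

lemma depth_le_add: "depth_le k x \<Longrightarrow> depth_le k y \<Longrightarrow> depth_le k (x + y)"
  by (erule (1) locally_shallow_subset[OF locally_shallow_Un]) (auto simp: hahn_supp_def)

lemma depth_le_uminus: "depth_le k x \<Longrightarrow> depth_le k (- x)"
  by (simp add: hahn_supp_def)

lemma depth_le_diff: "depth_le k x \<Longrightarrow> depth_le k y \<Longrightarrow> depth_le k (x - y)"
  unfolding minus_hahn_def by (intro depth_le_add depth_le_uminus)

lemma depth_le_sum: "(\<And>i. i \<in> I \<Longrightarrow> depth_le k (f i)) \<Longrightarrow> depth_le k (\<Sum>i\<in>I. f i)"
  by (induction I rule: infinite_finite_induct) (auto intro: depth_le_add)

lemma depth_le_mult:
  fixes x y :: "('k::semiring_0, rat) hahn"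
  shows "depth_le 0 x \<Longrightarrow> depth_le k y \<Longrightarrow> depth_le k (x * y)"
  by (rule locally_shallow_subset[OF locally_shallow_sums hahn_supp_times])

lemma depth_le_power:
  fixes x :: "('k::comm_ring_1, rat) hahn"
  shows "depth_le 0 x \<Longrightarrow> depth_le 0 (x ^ n)"
  by (induction n) (auto intro: depth_le_mult)

text \<open>The valuation of \<open>x\<close> is at least \<open>c\<close>, where the valuation of \<open>0\<close> is infinite.\<close>

definition val_ge :: "rat \<Rightarrow> ('k::zero, rat) hahn \<Rightarrow> bool"
  where "val_ge c x \<longleftrightarrow> (\<forall>g<c. hahn_nth x g = 0)"

lemma val_ge_mono: "val_ge c x \<Longrightarrow> d \<le> c \<Longrightarrow> val_ge d x"
  by (auto simp: val_ge_def)

lemma val_ge_0 [simp]: "val_ge c 0"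
  by (simp add: val_ge_def)

lemma val_ge_1 [simp]: "val_ge 0 1"
  by (simp add: val_ge_def one_hahn.rep_eq)

lemma val_ge_add: "val_ge c x \<Longrightarrow> val_ge c y \<Longrightarrow> val_ge c (x + y)"
  by (simp add: val_ge_def)

lemma val_ge_uminus: "val_ge c x \<Longrightarrow> val_ge c (- x)"
  by (simp add: val_ge_def)

lemma val_ge_diff: "val_ge c x \<Longrightarrow> val_ge c y \<Longrightarrow> val_ge c (x - y)"
  by (simp add: val_ge_def)

lemma val_ge_sum: "(\<And>i. i \<in> I \<Longrightarrow> val_ge c (f i)) \<Longrightarrow> val_ge c (\<Sum>i\<in>I. f i)"
  by (simp add: val_ge_def hahn_nth_sum)

lemma val_ge_mult:
  fixes x y :: "('k::semiring_0, rat) hahn"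
  assumes "val_ge c x" "val_ge d y"
  shows "val_ge (c + d) (x * y)"
  unfolding val_ge_def
proof (intro allI impI, rule ccontr)
  fix g assume g: "g < c + d" "hahn_nth (x * y) g \<noteq> 0"
  then have "g \<in> hahn_supp (x * y)" by (simp add: hahn_supp_def)
  then obtain a b where ab: "g = a + b" "a \<in> hahn_supp x" "b \<in> hahn_supp y"
    using hahn_supp_times by blast
  then have "c \<le> a" "d \<le> b"
    using assms by (auto simp: val_ge_def hahn_supp_def linorder_not_less[symmetric])
  then show False using ab(1) g(1) by simp
qed

lemma val_ge_power:
  fixes x :: "('k::comm_ring_1, rat) hahn"
  shows "val_ge c x \<Longrightarrow> val_ge (of_nat n * c) (x ^ n)"
proof (induction n)
  case (Suc n)
  then show ?case using val_ge_mult[of c x "of_nat n * c" "x ^ n"] by (simp add: algebra_simps)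
qed simp

lemma hahn_leading_term:
  fixes x :: "('k::zero, rat) hahn"
  assumes "x \<noteq> 0"
  obtains e where "hahn_nth x e \<noteq> 0" "val_ge e x"
proof -
  have "hahn_supp x \<noteq> {}"
    using assms by (auto simp: hahn_supp_def intro!: hahn_eqI)
  then obtain e where e: "e \<in> hahn_supp x" "\<And>a. a \<in> hahn_supp x \<Longrightarrow> e \<le> a"
    using well_ordered_least[OF well_ordered_supp] by blast
  show thesis
    by (rule that[of e]) (use e in \<open>force simp: val_ge_def hahn_supp_def\<close>)+
qed

text \<open>A left-finite series has a least exponent above \<open>c\<close>, so positive valuation is uniformly positive.\<close>

lemma hahn_gap:
  fixes x :: "('k::zero, rat) hahn"
  assumes "depth_le 0 x" "\<And>g. g \<le> c \<Longrightarrow> hahn_nth x g = 0"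
  obtains d where "d > c" "val_ge d x"
proof -
  define T where "T = insert (c + 1) (hahn_supp x \<inter> {..<c + 1})"
  have T: "finite T" "T \<noteq> {}" using assms(1) by (auto simp: T_def locally_shallow_def)
  have "t > c" if "t \<in> T" for t
    using that assms(2)[of t] by (force simp: T_def hahn_supp_def)
  then have "Min T > c" using T by simp
  moreover have "val_ge (Min T) x"
    unfolding val_ge_def
  proof (intro allI impI, rule ccontr)
    fix g assume g: "g < Min T" "hahn_nth x g \<noteq> 0"
    have "g < c + 1" using g(1) T Min_le[of T "c + 1"] by (simp add: T_def)
    then have "g \<in> T" using g(2) by (simp add: T_def hahn_supp_def)
    then show False using g(1) Min_le[OF T(1)] by (meson not_less)
  qed
  ultimately show thesis by (rule that)
qed

lift_definition hahn_monom :: "rat \<Rightarrow> 'k::zero \<Rightarrow> ('k, rat) hahn"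
  is "\<lambda>e c g. if g = e then c else 0"
  by (rule well_ordered_subset[OF well_ordered_singleton]) auto

lemma hahn_monom_0_1: "hahn_monom 0 1 = (1 :: ('k::zero_neq_one, rat) hahn)"
  by transfer auto

lemma depth_le_hahn_monom [simp]: "depth_le 0 (hahn_monom e c)"
  by (auto simp: locally_shallow_def hahn_supp_def hahn_monom.rep_eq)

lemma hahn_nth_hahn_monom_times:
  fixes x :: "('k::comm_ring_1, rat) hahn"
  shows "hahn_nth (hahn_monom e c * x) g = c * hahn_nth x (g - e)"
proof -
  have "hahn_nth (hahn_monom e c * x) g =
      (\<Sum>a | a \<in> {e} \<and> g - a \<in> hahn_supp x. hahn_nth (hahn_monom e c) a * hahn_nth x (g - a))"
    by (rule hahn_nth_times[OF well_ordered_singleton well_ordered_supp])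
      (auto simp: hahn_supp_def hahn_monom.rep_eq)
  also have "{a. a \<in> {e} \<and> g - a \<in> hahn_supp x} = (if g - e \<in> hahn_supp x then {e} else {})"
    by auto
  finally show ?thesis by (auto simp: hahn_monom.rep_eq hahn_supp_def)
qed

lemma hahn_monom_mult: "hahn_monom e c * hahn_monom f d = hahn_monom (e + f) (c * d :: 'k::comm_ring_1)"
  by (rule hahn_eqI) (auto simp: hahn_nth_hahn_monom_times hahn_monom.rep_eq algebra_simps)

lemma hahn_monom_power: "hahn_monom e c ^ n = hahn_monom (of_nat n * e) (c ^ n :: 'k::comm_ring_1)"
  by (induction n) (auto simp: hahn_monom_0_1 hahn_monom_mult algebra_simps)

lemma CHAR_hahn: "CHAR(('k::comm_ring_1, rat) hahn) = CHAR('k)"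
proof -
  have nth: "hahn_nth (of_nat n :: ('k, rat) hahn) g = (if g = 0 then of_nat n else 0)" for n g
    by (induction n) (auto simp: one_hahn.rep_eq)
  have eq: "of_nat n = (0 :: ('k, rat) hahn) \<longleftrightarrow> of_nat n = (0 :: 'k)" for n
  proof
    assume "of_nat n = (0 :: ('k, rat) hahn)"
    then have "hahn_nth (of_nat n :: ('k, rat) hahn) 0 = 0" by simp
    then show "of_nat n = (0 :: 'k)" by (simp add: nth)
  qed (auto intro: hahn_eqI simp: nth)
  show ?thesis
    by (rule CHAR_eqI) (simp_all add: eq of_nat_eq_0_iff_char_dvd)
qed

lemma frobenius_add:
  fixes x y :: "('k::comm_ring_1, rat) hahn"
  assumes "prime p" "CHAR('k) = p"
  shows "(x + y) ^ (p ^ i) = x ^ (p ^ i) + y ^ (p ^ i)"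
  by (rule freshmans_dream'[where n = i]) (use assms in \<open>simp_all add: CHAR_hahn\<close>)

lemma frobenius_diff:
  fixes x y :: "('k::comm_ring_1, rat) hahn"
  assumes "prime p" "CHAR('k) = p"
  shows "(x - y) ^ (p ^ i) = x ^ (p ^ i) - y ^ (p ^ i)"
  using frobenius_add[OF assms, of "x - y" y i] by (simp add: algebra_simps)

lemma hahn_supp_power_below:
  fixes x :: "('k::comm_ring_1, rat) hahn"
  assumes "hahn_supp x \<subseteq> {..<c}"
  shows "hahn_supp (x ^ Suc n) \<subseteq> {..<of_nat (Suc n) * c}"
proof (induction n)
  case (Suc n)
  show ?case
  proof
    fix g assume "g \<in> hahn_supp (x ^ Suc (Suc n))"
    then obtain a b where "g = a + b" "a \<in> hahn_supp x" "b \<in> hahn_supp (x ^ Suc n)"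
      using hahn_supp_times[of x "x ^ Suc n"] by auto
    then have "g < c + of_nat (Suc n) * c"
      using add_strict_mono[of a c b "of_nat (Suc n) * c"] Suc assms by blast
    then show "g \<in> {..<of_nat (Suc (Suc n)) * c}" by (simp add: algebra_simps)
  qed
qed (use assms in simp)

lemma hahn_supp_power_above:
  fixes x :: "('k::comm_ring_1, rat) hahn"
  assumes "hahn_supp x \<subseteq> {c<..}"
  shows "hahn_supp (x ^ Suc n) \<subseteq> {of_nat (Suc n) * c<..}"
proof (induction n)
  case (Suc n)
  show ?case
  proof
    fix g assume "g \<in> hahn_supp (x ^ Suc (Suc n))"
    then obtain a b where "g = a + b" "a \<in> hahn_supp x" "b \<in> hahn_supp (x ^ Suc n)"
      using hahn_supp_times[of x "x ^ Suc n"] by auto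
    then have "c + of_nat (Suc n) * c < g"
      using add_strict_mono[of c a "of_nat (Suc n) * c" b] Suc assms by blast
    then show "g \<in> {of_nat (Suc (Suc n)) * c<..}" by (simp add: algebra_simps)
  qed
qed (use assms in simp)

lift_definition hahn_restrict :: "rat set \<Rightarrow> ('k::zero, rat) hahn \<Rightarrow> ('k, rat) hahn"
  is "\<lambda>A x g. if g \<in> A then x g else 0"
  by (erule well_ordered_subset) auto

text \<open>Frobenius acts coefficientwise. By additivity it is enough to split \<open>x\<close> at the exponent \<open>g\<close>: the
  \<open>p\<close>-th powers of the parts below and above \<open>g\<close> have exponents strictly below and strictly above
  \<open>p * g\<close>, so only the middle term is seen there.\<close>

lemma hahn_nth_frobenius:
  fixes x :: "('k::comm_ring_1, rat) hahn"
  assumes p: "prime p" "CHAR('k) = p"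
  shows "hahn_nth (x ^ p) (of_nat p * g) = hahn_nth x g ^ p"
proof -
  define l u where "l = hahn_restrict {..<g} x" and "u = hahn_restrict {g<..} x"
  have x: "x = l + hahn_monom g (hahn_nth x g) + u"
    by (rule hahn_eqI) (auto simp: l_def u_def hahn_restrict.rep_eq hahn_monom.rep_eq)
  obtain n where n: "p = Suc n" using p(1) by (metis not_prime_0 not0_implies_Suc)
  have pw: "x ^ p = l ^ p + hahn_monom (of_nat p * g) (hahn_nth x g ^ p) + u ^ p"
    using frobenius_add[OF p, of _ _ 1] by (subst x) (simp add: hahn_monom_power)
  have "hahn_supp l \<subseteq> {..<g}" "hahn_supp u \<subseteq> {g<..}"
    by (auto simp: l_def u_def hahn_supp_def hahn_restrict.rep_eq)
  then have "of_nat p * g \<notin> hahn_supp (l ^ p)" "of_nat p * g \<notin> hahn_supp (u ^ p)"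
    using hahn_supp_power_below[of l g n] hahn_supp_power_above[of u g n] unfolding n by auto
  then show ?thesis
    unfolding pw by (simp add: hahn_nth_eq_0_iff[symmetric] hahn_monom.rep_eq)
qed

lemma depth_le_if_depth_le_frobenius:
  fixes x :: "('k::idom, rat) hahn"
  assumes p: "prime p" "CHAR('k) = p" and "depth_le k (x ^ p)"
  shows "depth_le k x"
proof -
  have p0: "p > 0" using p(1) by (rule prime_gt_0_nat)
  have "locally_shallow k ((\<lambda>g. (1 / of_nat p) * g) ` hahn_supp (x ^ p))"
    using assms(3) p0 by (intro locally_shallow_scale) simp_all
  moreover have "hahn_supp x \<subseteq> (\<lambda>g. (1 / of_nat p) * g) ` hahn_supp (x ^ p)"
  proof
    fix g assume "g \<in> hahn_supp x"
    then have "of_nat p * g \<in> hahn_supp (x ^ p)"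
      by (simp add: hahn_supp_def hahn_nth_frobenius[OF p])
    moreover have "g = (1 / of_nat p) * (of_nat p * g)" using p0 by simp
    ultimately show "g \<in> (\<lambda>g. (1 / of_nat p) * g) ` hahn_supp (x ^ p)" by blast
  qed
  ultimately show ?thesis by (rule locally_shallow_subset)
qed

text \<open>At the exponent \<open>p * g\<close> the equation \<open>z ^ p - z = w\<close> compares the coefficients of \<open>z\<close> at \<open>g\<close> and
  at \<open>p * g\<close>. Hence an exponent of \<open>z\<close> can be multiplied by \<open>p\<close>, or divided by \<open>p\<close>, until an exponent
  of \<open>w\<close> is met. Choosing the direction in which the exponents decrease, this has to happen because
  the support of \<open>z\<close> is well-ordered.\<close>

lemma depth_le_artin_schreier:
  fixes z :: "('k::idom, rat) hahn"
  assumes p: "prime p" "CHAR('k) = p" and w: "depth_le k (z ^ p - z)"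
  shows "depth_le (Suc k) z"
proof (rule locally_shallow_frobenius_orbits[OF prime_ge_2_nat[OF p(1)] w well_ordered_supp])
  let ?w = "z ^ p - z" and ?q = "of_nat p :: rat"
  have q: "?q > 1" using prime_ge_2_nat[OF p(1)] by simp
  have w_nth: "hahn_nth ?w (?q * g) = hahn_nth z g ^ p - hahn_nth z (?q * g)" for g
    by (simp add: hahn_nth_frobenius[OF p])
  show "\<exists>m. \<forall>g\<in>hahn_supp z. m \<le> g"
    using well_ordered_least[OF well_ordered_supp, of z] by (metis empty_iff)
  show "\<exists>i. ?q ^ i * g \<in> hahn_supp ?w" if g: "g \<in> hahn_supp z" "g < 0" for g
  proof (rule ccontr)
    assume neg: "\<nexists>i. ?q ^ i * g \<in> hahn_supp ?w"
    have z: "?q ^ i * g \<in> hahn_supp z" for i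
    proof (induction i)
      case (Suc i)
      have "?q * (?q ^ i * g) \<notin> hahn_supp ?w" using neg by (metis mult.assoc power_Suc)
      then show ?case
        using Suc w_nth[of "?q ^ i * g"] by (auto simp: hahn_supp_def mult.assoc)
    qed (use g in simp)
    show False
    proof (rule well_ordered_no_strict_antimono[OF well_ordered_supp z])
      show "?q ^ j * g < ?q ^ i * g" if "i < j" for i j
        using g(2) q that power_strict_increasing[of i j ?q] by simp
    qed
  qed
  show "\<exists>i. g / ?q ^ i \<in> hahn_supp ?w" if g: "g \<in> hahn_supp z" "g > 0" for g
  proof (rule ccontr)
    assume neg: "\<nexists>i. g / ?q ^ i \<in> hahn_supp ?w"
    have z: "g / ?q ^ i \<in> hahn_supp z" for i
    proof (induction i)
      case (Suc i)
      have eq: "?q * (g / ?q ^ Suc i) = g / ?q ^ i" using q by simp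
      show ?case
        using Suc neg w_nth[of "g / ?q ^ Suc i"] prime_gt_0_nat[OF p(1)] unfolding eq
        by (auto simp: hahn_supp_def power_0_left)
    qed (use g in simp)
    show False
    proof (rule well_ordered_no_strict_antimono[OF well_ordered_supp z])
      show "g / ?q ^ j < g / ?q ^ i" if "i < j" for i j
        using g(2) q that by (intro divide_strict_left_mono power_strict_increasing) auto
    qed
  qed
qed

section \<open>Series with left-finite support\<close>

lemma well_ordered_if_left_finite:
  fixes S :: "rat set"
  assumes "\<And>B. finite (S \<inter> {..<B})"
  shows "well_ordered S"
  unfolding well_ordered_iff_no_descent
proof
  assume "\<exists>s :: nat \<Rightarrow> rat. range s \<subseteq> S \<and> (\<forall>n. s (Suc n) < s n)"
  then obtain s :: "nat \<Rightarrow> rat" where s: "range s \<subseteq> S" "\<And>n. s (Suc n) < s n" by blast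
  have anti: "s n < s m" if "m < n" for m n
    using that by (induction n) (auto simp: less_Suc_eq intro: s(2) order.strict_trans)
  then have "inj (\<lambda>n. s (Suc n))"
    by (intro injI) (metis Suc_less_eq less_irrefl linorder_neqE_nat)
  moreover have "range (\<lambda>n. s (Suc n)) \<subseteq> S \<inter> {..<s 0}"
    using s(1) anti[of 0] by auto
  ultimately show False
    using assms finite_subset finite_imageD infinite_UNIV_nat by blast
qed

text \<open>The iterates of \<open>0\<close> agree with each other below \<open>c + n * g\<close> from the \<open>n\<close>-th one on. So each
  initial part of the limit is an initial part of an iterate, and left-finiteness survives.\<close>

lemma hahn_contraction_fixpoint:
  fixes F :: "('k::comm_ring_1, rat) hahn \<Rightarrow> ('k, rat) hahn"
  assumes g: "g > 0"
    and ball: "\<And>y. val_ge c y \<Longrightarrow> val_ge c (F y)"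
    and contr: "\<And>y z d. c \<le> d \<Longrightarrow> val_ge c y \<Longrightarrow> val_ge c z \<Longrightarrow> val_ge d (y - z) \<Longrightarrow> val_ge (d + g) (F y - F z)"
    and left_fin: "\<And>y. depth_le 0 y \<Longrightarrow> depth_le 0 (F y)"
  obtains y where "depth_le 0 y" "val_ge c y" "F y = y"
proof -
  define Y where "Y n = (F ^^ n) 0" for n
  have Y_Suc: "Y (Suc n) = F (Y n)" for n by (simp add: Y_def)
  have Yc: "val_ge c (Y n)" for n
  proof (induction n)
    case 0 then show ?case by (simp add: Y_def)
  qed (simp add: Y_Suc ball)
  have Yt: "depth_le 0 (Y n)" for n
  proof (induction n)
    case 0 then show ?case by (simp add: Y_def)
  qed (simp only: Y_Suc left_fin)
  have step: "val_ge (c + of_nat n * g) (Y (Suc n) - Y n)" for n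
  proof (induction n)
    case 0
    show ?case using val_ge_diff[OF Yc[of "Suc 0"] Yc[of 0]] by simp
  next
    case (Suc n)
    have "val_ge (c + of_nat n * g + g) (F (Y (Suc n)) - F (Y n))"
      by (rule contr) (use Yc Suc g in auto)
    then show ?case by (simp add: Y_Suc[symmetric] algebra_simps)
  qed
  have diff: "val_ge (c + of_nat n * g) (Y (n + m) - Y n)" for n m
  proof (induction m)
    case (Suc m)
    have "val_ge (c + of_nat n * g) (Y (Suc (n + m)) - Y (n + m))"
      by (rule val_ge_mono[OF step]) (use g in simp)
    from val_ge_add[OF this Suc] show ?case by simp
  qed simp
  have "\<exists>n. b < c + of_nat n * g" for b
    using ex_less_of_nat_mult[OF g, of "b - c"] by (metis add.commute diff_less_eq)
  then obtain N where N: "\<And>b. b < c + of_nat (N b) * g" by metis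
  have stable: "hahn_nth (Y m) b = hahn_nth (Y n) b"
    if b: "b < c + of_nat n * g" "b < c + of_nat m * g" for m n b
  proof (cases "n \<le> m")
    case True
    then show ?thesis using diff[of n "m - n"] b by (simp add: val_ge_def)
  next
    case False
    then show ?thesis using diff[of m "n - m"] b by (simp add: val_ge_def)
  qed
  \<comment> \<open>the limit, read off at each exponent from an iterate that is already stable there\<close>
  define f where "f b = hahn_nth (Y (N b)) b" for b
  have f: "f b = hahn_nth (Y n) b" if "b < c + of_nat n * g" for b n
    unfolding f_def by (rule stable[OF that N])
  have fin: "finite ({b. f b \<noteq> 0} \<inter> {..<B})" for B
  proof (rule finite_subset)
    show "finite (hahn_supp (Y (N B)) \<inter> {..<B})" using Yt[of "N B"] by (simp add: locally_shallow_def)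
    show "{b. f b \<noteq> 0} \<inter> {..<B} \<subseteq> hahn_supp (Y (N B)) \<inter> {..<B}"
      using f[of _ "N B"] N[of B] by (auto simp: hahn_supp_def)
  qed
  define y where "y = Abs_hahn f"
  have y: "hahn_nth y = f"
    unfolding y_def using well_ordered_if_left_finite[OF fin] by (intro Abs_hahn_inverse) simp
  have yY: "val_ge (c + of_nat n * g) (y - Y n)" for n
    by (simp add: val_ge_def y f)
  have yc: "val_ge c y"
    using val_ge_add[OF yY[of 0, simplified] Yc[of 0]] by simp
  have "depth_le 0 y"
    using fin yc unfolding locally_shallow_def hahn_supp_def y val_ge_def
    by (auto intro!: exI[of _ c] simp: linorder_not_less[symmetric])
  moreover have "F y = y"
  proof -
    have "val_ge (c + of_nat n * g) (F y - y)" for n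
    proof -
      have "val_ge (c + of_nat n * g + g) (F y - F (Y n))"
        by (rule contr) (use yc Yc yY g in auto)
      then have "val_ge (c + of_nat (Suc n) * g) (F y - Y (Suc n))"
        by (simp add: Y_Suc algebra_simps)
      from val_ge_diff[OF this yY[of "Suc n"]] 
      have "val_ge (c + of_nat (Suc n) * g) (F y - y)" by simp
      then show ?thesis by (rule val_ge_mono) (use g in simp)
    qed
    then have "hahn_nth (F y - y) b = 0" for b using N[of b] by (auto simp: val_ge_def)
    then have "F y - y = 0" by (intro hahn_eqI) simp
    then show ?thesis by simp
  qed
  ultimately show thesis using yc that by blast
qed

text \<open>After scaling, \<open>x = 1 - h\<close> with \<open>h\<close> of positive valuation, and the inverse is the geometric
  series in \<open>h\<close>, the fixed point of \<open>y \<mapsto> 1 + h * y\<close>.\<close>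

lemma left_finite_inverse:
  fixes x :: "('k::field, rat) hahn"
  assumes "depth_le 0 x" "x \<noteq> 0"
  obtains y where "depth_le 0 y" "x * y = 1"
proof -
  obtain e where e: "hahn_nth x e \<noteq> 0" "val_ge e x"
    using hahn_leading_term[OF assms(2)] by blast
  define m where "m = hahn_monom (- e) (inverse (hahn_nth x e))"
  define h where "h = 1 - m * x"
  have h: "depth_le 0 h"
    unfolding h_def m_def using assms(1) by (intro depth_le_diff depth_le_mult) simp_all
  have "hahn_nth h g = 0" if "g \<le> 0" for g
    using that e by (cases "g = 0") (auto simp: h_def m_def hahn_nth_hahn_monom_times one_hahn.rep_eq val_ge_def)
  then obtain d where d: "d > 0" "val_ge d h" using hahn_gap[OF h] by blast
  obtain y where y: "depth_le 0 y" "1 + h * y = y"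
  proof (rule hahn_contraction_fixpoint[OF d(1), of 0 "\<lambda>y. 1 + h * y"])
    show "val_ge 0 (1 + h * y)" if "val_ge 0 y" for y
      using val_ge_mono[OF val_ge_mult[OF d(2) that], of 0] d(1) by (intro val_ge_add) auto
    show "val_ge (a + d) ((1 + h * y) - (1 + h * z))" if "val_ge a (y - z)" for a y z
      using val_ge_mult[OF d(2) that] by (simp add: algebra_simps)
    show "depth_le 0 (1 + h * y)" if "depth_le 0 y" for y
      using that h by (intro depth_le_add depth_le_mult) simp_all
  qed blast
  have "m * x * y = y - h * y" by (simp add: h_def algebra_simps)
  also have "\<dots> = 1" using y(2) by (simp add: algebra_simps)
  finally have "x * (m * y) = 1" by (simp add: algebra_simps)
  moreover have "depth_le 0 (m * y)"
    unfolding m_def using y(1) by (intro depth_le_mult) simp_all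
  ultimately show thesis using that by blast
qed

section \<open>Additive polynomials over the left-finite series\<close>

text \<open>Divide the additive polynomial by its variable: the result is not constant and does not vanish
  at \<open>0\<close>.\<close>

lemma additive_residue_root:
  fixes r :: "nat \<Rightarrow> 'k::alg_closed_field"
  assumes p: "p \<ge> 2" and r0: "r 0 \<noteq> 0" and j: "0 < j" "j \<le> d" "r j \<noteq> 0"
  obtains w where "w \<noteq> 0" "(\<Sum>i\<le>d. r i * w ^ (p ^ i)) = 0"
proof -
  define q where "q = (\<Sum>i\<le>d. monom (r i) (p ^ i - 1))"
  have inj: "p ^ i - 1 = p ^ l - 1 \<longleftrightarrow> i = l" for i l
  proof -
    have "p ^ i \<ge> 1" "p ^ l \<ge> 1" using p by simp_all
    then have "p ^ i - 1 = p ^ l - 1 \<longleftrightarrow> p ^ i = p ^ l" by (rule eq_diff_iff)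
    also have "\<dots> \<longleftrightarrow> i = l" by (rule power_inject_exp) (use p in simp)
    finally show ?thesis .
  qed
  have coeff: "coeff q (p ^ l - 1) = r l" if "l \<le> d" for l
    unfolding q_def coeff_sum coeff_monom inj using that by simp
  have "p ^ j - 1 > 0" using one_less_power[of p j] p j(1) by simp
  then have "degree q > 0" using le_degree[of q "p ^ j - 1"] coeff[of j] j by simp
  then obtain w where w: "poly q w = 0" using alg_closed_imp_poly_has_root by blast
  have "w \<noteq> 0"
  proof
    assume "w = 0"
    then have "coeff q (p ^ 0 - 1) = 0" using w by (simp add: poly_0_coeff_0)
    then show False using coeff[of 0] r0 by simp
  qed
  moreover have "(\<Sum>i\<le>d. r i * w ^ (p ^ i)) = w * poly q w"
  proof -
    have "w ^ (p ^ i) = w * w ^ (p ^ i - 1)" for i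
      using p by (metis power_eq_if power_eq_0_iff not_numeral_le_zero)
    then show ?thesis
      by (simp add: q_def poly_sum poly_monom sum_distrib_left algebra_simps)
  qed
  ultimately show thesis using w that by simp
qed

text \<open>The case where the largest valuation of a root is \<open>0\<close>. The residues of the coefficients give an
  additive polynomial over \<open>'k\<close>; a nonzero root of it is corrected by a \<open>y\<close> of positive
  valuation. As \<open>c 0 = 1\<close>, the equation for \<open>y\<close> is a fixed point equation, and it is contracting
  because \<open>p\<close>-th powers at least double a positive valuation.\<close>

lemma additive_root_slope_zero:
  fixes c :: "nat \<Rightarrow> ('k::alg_closed_field, rat) hahn"
  assumes p: "prime p" "CHAR('k) = p"
    and c: "\<And>i. i \<le> d \<Longrightarrow> depth_le 0 (c i)" "\<And>i. i \<le> d \<Longrightarrow> val_ge 0 (c i)"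
    and c0: "c 0 = 1" and j: "0 < j" "j \<le> d" "hahn_nth (c j) 0 \<noteq> 0"
  obtains w where "depth_le 0 w" "w \<noteq> 0" "(\<Sum>i\<le>d. c i * w ^ (p ^ i)) = 0"
proof -
  have p2: "p \<ge> 2" using p(1) by (rule prime_ge_2_nat)
  obtain l where l: "l \<noteq> 0" "(\<Sum>i\<le>d. hahn_nth (c i) 0 * l ^ (p ^ i)) = 0"
    by (rule additive_residue_root[OF p2, of "\<lambda>i. hahn_nth (c i) 0" j d])
      (use c0 j in \<open>auto simp: one_hahn.rep_eq\<close>)
  define w where "w = hahn_monom 0 l"
  \<comment> \<open>the error of the first approximation; it has no term of exponent \<open>\<le> 0\<close>\<close>
  define R where "R = (\<Sum>i\<le>d. c i * w ^ (p ^ i))"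
  have w_pow: "c i * w ^ n = hahn_monom 0 (l ^ n) * c i" for i n
    by (simp add: w_def hahn_monom_power mult.commute)
  have R_nth: "hahn_nth R g = (\<Sum>i\<le>d. l ^ (p ^ i) * hahn_nth (c i) g)" for g
    by (simp add: R_def w_pow hahn_nth_sum hahn_nth_hahn_monom_times)
  have R: "depth_le 0 R"
    unfolding R_def w_def using c(1) by (intro depth_le_sum depth_le_mult depth_le_power) simp_all
  have "hahn_nth R g = 0" if "g \<le> 0" for g
  proof (cases "g = 0")
    case True
    then show ?thesis using l(2) by (simp add: R_nth mult.commute)
  next
    case False
    then have "hahn_nth (c i) g = 0" if "i \<le> d" for i
      using c(2)[OF that] \<open>g \<le> 0\<close> by (simp add: val_ge_def)
    then show ?thesis by (simp add: R_nth)
  qed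
  then obtain g where g: "g > 0" "val_ge g R" using hahn_gap[OF R] by blast
  have high: "val_ge (a + g) (c i * y ^ (p ^ i))" if "i \<in> {1..d}" "g \<le> a" "val_ge a y" for i a y
  proof -
    have "val_ge (0 + of_nat (p ^ i) * a) (c i * y ^ (p ^ i))"
      using that c(2) by (intro val_ge_mult val_ge_power) auto
    moreover have "2 \<le> p ^ i"
      using that p2 by (metis atLeastAtMost_iff le_trans less_eq_Suc_le One_nat_def self_le_power
          not_gr_zero not_one_le_zero zero_less_one less_le_trans zero_less_numeral)
    then have "2 * a \<le> of_nat (p ^ i) * a"
      using g(1) that(2) by (intro mult_right_mono) (metis of_nat_le_iff of_nat_numeral, simp)
    ultimately show ?thesis using that(2) by (elim val_ge_mono) simp
  qed
  define F where "F y = - (R + (\<Sum>i=1..d. c i * y ^ (p ^ i)))" for y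
  obtain y where y: "depth_le 0 y" "val_ge g y" "F y = y"
  proof (rule hahn_contraction_fixpoint[OF g(1), of g F])
    show "val_ge g (F y)" if "val_ge g y" for y
      unfolding F_def using g that
      by (intro val_ge_uminus val_ge_add val_ge_sum val_ge_mono[OF high[of _ g y]]) auto
    show "val_ge (a + g) (F y - F z)" if "g \<le> a" "val_ge a (y - z)" for a y z
    proof -
      have "F y - F z = - (\<Sum>i=1..d. c i * (y - z) ^ (p ^ i))"
        by (simp add: F_def frobenius_diff[OF p] algebra_simps sum_subtractf)
      then show ?thesis
        using high[OF _ that] by (auto intro!: val_ge_uminus val_ge_sum)
    qed
    show "depth_le 0 (F y)" if "depth_le 0 y" for y
      unfolding F_def using R c(1) that
      by (intro depth_le_uminus depth_le_add depth_le_sum depth_le_mult depth_le_power) auto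
  qed blast
  have "(\<Sum>i\<le>d. c i * (w + y) ^ (p ^ i)) = R + (\<Sum>i\<le>d. c i * y ^ (p ^ i))"
    by (simp add: R_def frobenius_add[OF p] distrib_left sum.distrib)
  also have "\<dots> = y - F y"
  proof -
    have "{..d} = insert 0 {1..d}" by auto
    then show ?thesis by (simp add: F_def c0)
  qed
  finally have "(\<Sum>i\<le>d. c i * (w + y) ^ (p ^ i)) = 0" using y(3) by simp
  moreover have "hahn_nth (w + y) 0 \<noteq> 0"
    using l(1) y(2) g(1) by (simp add: w_def hahn_monom.rep_eq val_ge_def)
  then have "w + y \<noteq> 0" by (metis hahn_nth_0)
  moreover have "depth_le 0 (w + y)"
    using y(1) by (simp add: w_def depth_le_add)
  ultimately show thesis using that by blast
qed

text \<open>Substituting \<open>hahn_monom e 1 * w\<close> for the unknown reduces to slope zero. Here \<open>e\<close> is the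
  largest of the numbers \<open>- v i / (p ^ i - 1)\<close> with \<open>v i\<close> the valuation of \<open>a i / a 0\<close>. This is the
  largest valuation of a root: the linear term has to be cancelled by a term of index \<open>i > 0\<close>, which
  happens at that valuation, and the maximal choice makes all other terms at least as small.\<close>

lemma additive_root:
  fixes a :: "nat \<Rightarrow> ('k::alg_closed_field, rat) hahn"
  assumes p: "prime p" "CHAR('k) = p"
    and a: "\<And>i. i \<le> d \<Longrightarrow> depth_le 0 (a i)" and nz: "a 0 \<noteq> 0" "a d \<noteq> 0" "d > 0"
  obtains u where "depth_le 0 u" "u \<noteq> 0" "(\<Sum>i\<le>d. a i * u ^ (p ^ i)) = 0"
proof -
  have p2: "p \<ge> 2" using p(1) by (rule prime_ge_2_nat)
  obtain a' where a': "depth_le 0 a'" "a 0 * a' = 1"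
    using left_finite_inverse[OF a nz(1)] by auto
  define b where "b i = a' * a i" for i
  have ab: "a i = a 0 * b i" for i
    using a'(2) by (simp add: b_def mult.assoc[symmetric])
  have b0: "b 0 = 1" using a'(2) by (simp add: b_def mult.commute)
  have "\<exists>v. b i \<noteq> 0 \<longrightarrow> hahn_nth (b i) v \<noteq> 0 \<and> val_ge v (b i)" for i
    using hahn_leading_term by metis
  then obtain v where v: "\<And>i. b i \<noteq> 0 \<Longrightarrow> hahn_nth (b i) (v i) \<noteq> 0"
    "\<And>i. b i \<noteq> 0 \<Longrightarrow> val_ge (v i) (b i)" by metis
  define I where "I = {i \<in> {1..d}. b i \<noteq> 0}"
  have "d \<in> I" using nz ab[of d] by (auto simp: I_def)
  define q where "q i = (of_nat (p ^ i) - 1 :: rat)" for i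
  have q: "q i > 0" if "i > 0" for i
  proof -
    have "1 < p ^ i" by (rule one_less_power) (use p2 that in auto)
    then have "(1 :: rat) < of_nat (p ^ i)" by (metis of_nat_1 of_nat_less_iff)
    then show ?thesis by (simp add: q_def)
  qed
  define e where "e = Max ((\<lambda>i. - v i / q i) ` I)"
  have I: "finite ((\<lambda>i. - v i / q i) ` I)" "(\<lambda>i. - v i / q i) ` I \<noteq> {}"
    using \<open>d \<in> I\<close> by (auto simp: I_def)
  obtain j where j: "j \<in> I" "e = - v j / q j"
    using Max_in[OF I] unfolding e_def by blast
  have e: "v i + q i * e \<ge> 0" if "i \<in> I" for i
  proof -
    have "- v i / q i \<le> e" unfolding e_def using I that by (intro Max_ge) auto
    then show ?thesis using q[of i] that by (simp add: I_def field_simps)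
  qed
  define c where "c i = hahn_monom (q i * e) 1 * b i" for i
  have c_nth: "hahn_nth (c i) g = hahn_nth (b i) (g - q i * e)" for i g
    by (simp add: c_def hahn_nth_hahn_monom_times)
  obtain w where w: "depth_le 0 w" "w \<noteq> 0" "(\<Sum>i\<le>d. c i * w ^ (p ^ i)) = 0"
  proof (rule additive_root_slope_zero[OF p, of d c j])
    show "depth_le 0 (c i)" if "i \<le> d" for i
      unfolding c_def b_def using a a'(1) that by (intro depth_le_mult) simp_all
    show c0: "c 0 = 1"
      by (simp add: c_def b0 q_def hahn_monom_0_1)
    show "val_ge 0 (c i)" if "i \<le> d" for i
    proof (cases "i \<in> I")
      case True
      then show ?thesis
        using v(2)[of i] e[OF True] by (auto simp: val_ge_def c_nth I_def)
    next
      case False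
      then have "i = 0 \<or> b i = 0" using that by (auto simp: I_def)
      then show ?thesis using c0 by (auto simp: c_def)
    qed
    show "0 < j" "j \<le> d" using j(1) by (auto simp: I_def)
    have "0 - q j * e = v j" using j q[of j] by (simp add: I_def)
    then show "hahn_nth (c j) 0 \<noteq> 0" using v(1)[of j] j(1) by (simp add: c_nth I_def)
  qed blast
  define u where "u = hahn_monom e 1 * w"
  have "a i * u ^ (p ^ i) = a 0 * hahn_monom e 1 * (c i * w ^ (p ^ i))" for i
  proof -
    have "hahn_monom e 1 * hahn_monom (q i * e) 1 = (hahn_monom e 1 ^ (p ^ i) :: ('k, rat) hahn)"
      by (simp add: hahn_monom_mult hahn_monom_power q_def algebra_simps)
    then show ?thesis
      by (simp add: u_def c_def power_mult_distrib ab[of i] mult_ac)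
  qed
  then have "(\<Sum>i\<le>d. a i * u ^ (p ^ i)) = 0"
    using w(3) by (simp flip: sum_distrib_left)
  moreover have "depth_le 0 u" unfolding u_def using w(1) by (intro depth_le_mult) simp_all
  moreover have "hahn_nth (hahn_monom e (1 :: 'k)) e \<noteq> hahn_nth 0 e"
    by (simp add: hahn_monom.rep_eq)
  then have "hahn_monom e (1 :: 'k) \<noteq> 0" by metis
  then have "u \<noteq> 0" using w(2) by (simp add: u_def)
  ultimately show thesis using that by blast
qed

lemma sum_by_parts:
  fixes b y :: "nat \<Rightarrow> 'a::comm_ring_1"
  shows "(\<Sum>i\<le>n. b i * y i) =
    (\<Sum>i\<le>n. b i) * y 0 + (\<Sum>j<n. (\<Sum>i\<in>{j<..n}. b i) * (y (Suc j) - y j))"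
proof (induction n)
  case (Suc n)
  have "(\<Sum>i\<in>{j<..Suc n}. b i) = (\<Sum>i\<in>{j<..n}. b i) + b (Suc n)" if "j \<le> n" for j
  proof -
    have "{j<..Suc n} = insert (Suc n) {j<..n}" using that by auto
    then show ?thesis by (simp add: add.commute)
  qed
  then have "(\<Sum>j<Suc n. (\<Sum>i\<in>{j<..Suc n}. b i) * (y (Suc j) - y j)) =
    (\<Sum>j<Suc n. (\<Sum>i\<in>{j<..n}. b i) * (y (Suc j) - y j)) + b (Suc n) * (\<Sum>j<Suc n. y (Suc j) - y j)"
    by (simp add: distrib_right sum.distrib sum_distrib_left del: sum.lessThan_Suc)
  also have "(\<Sum>j<Suc n. y (Suc j) - y j) = y (Suc n) - y 0"
    by (rule sum_lessThan_telescope)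
  finally show ?case using Suc by (simp add: algebra_simps)
qed simp

text \<open>Induction on \<open>d\<close>. If the linear term is missing, the equation is one of smaller degree for
  \<open>x ^ p\<close>, whose support is a rescaling of that of \<open>x\<close>. Otherwise there is a root \<open>u\<close>, and
  \<open>z = x / u\<close> satisfies an equation for which \<open>1\<close> is a root, that is, with coefficient sum \<open>0\<close>. By
  summation by parts, and since \<open>p ^ j\<close>-th powers are additive, it is an equation of smaller degree
  for \<open>z ^ p - z\<close>.\<close>

lemma depth_le_if_additive_equation:
  fixes x :: "('k::alg_closed_field, rat) hahn"
  assumes p: "prime p" "CHAR('k) = p"
  shows "(\<And>i. i \<le> d \<Longrightarrow> depth_le 0 (a i)) \<Longrightarrow> a d \<noteq> 0 \<Longrightarrow>
    depth_le k (\<Sum>i\<le>d. a i * x ^ (p ^ i)) \<Longrightarrow> depth_le (k + d) x"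
proof (induction d arbitrary: a x)
  case 0
  obtain a' where a': "depth_le 0 a'" "a 0 * a' = 1"
    using left_finite_inverse[of "a 0"] 0 by auto
  have x: "a' * (a 0 * x) = x" using a'(2) by (metis mult.assoc mult.commute mult_1)
  have "depth_le k (a 0 * x)" using 0(3) by simp
  from depth_le_mult[OF a'(1) this] show ?case unfolding x by simp
next
  case (Suc d)
  show ?case
  proof (cases "a 0 = 0")
    case True
    have "(\<Sum>i\<le>Suc d. a i * x ^ (p ^ i)) = (\<Sum>i\<le>d. a (Suc i) * (x ^ p) ^ (p ^ i))"
      using True by (simp add: sum.atMost_Suc_shift power_mult[symmetric] del: sum.atMost_Suc)
    then have "depth_le (k + d) (x ^ p)"
      using Suc.prems by (intro Suc.IH[of "\<lambda>i. a (Suc i)"]) (simp_all del: sum.atMost_Suc)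
    then show ?thesis
      using depth_le_if_depth_le_frobenius[OF p] locally_shallow_mono[of "k + d" _ "k + Suc d"] by simp
  next
    case False
    then obtain u where u: "depth_le 0 u" "u \<noteq> 0" "(\<Sum>i\<le>Suc d. a i * u ^ (p ^ i)) = 0"
      using additive_root[OF p, of "Suc d" a] Suc.prems by blast
    obtain u' where u': "depth_le 0 u'" "u * u' = 1"
      using left_finite_inverse[OF u(1,2)] by blast
    define z where "z = u' * x"
    have x: "x = u * z" using u'(2) by (simp add: z_def mult.assoc[symmetric])
    define b where "b i = a i * u ^ (p ^ i)" for i
    define A where "A j = (\<Sum>i\<in>{j<..Suc d}. b i)" for j
    have "(\<Sum>i\<le>Suc d. a i * x ^ (p ^ i)) = (\<Sum>i\<le>Suc d. b i * z ^ (p ^ i))"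
      by (simp add: x b_def power_mult_distrib mult.assoc del: sum.atMost_Suc)
    also have "\<dots> = (\<Sum>j<Suc d. A j * (z ^ (p ^ Suc j) - z ^ (p ^ j)))"
      using u(3) unfolding A_def
      by (subst sum_by_parts) (simp add: b_def del: sum.atMost_Suc sum.lessThan_Suc power_Suc)
    also have "\<dots> = (\<Sum>j\<le>d. A j * (z ^ p - z) ^ (p ^ j))"
      unfolding lessThan_Suc_atMost
      by (simp add: frobenius_diff[OF p] power_mult[symmetric])
    finally have eq: "(\<Sum>i\<le>Suc d. a i * x ^ (p ^ i)) = (\<Sum>j\<le>d. A j * (z ^ p - z) ^ (p ^ j))" .
    have "depth_le (k + d) (z ^ p - z)"
    proof (rule Suc.IH)
      show "depth_le 0 (A i)" for i
        unfolding A_def b_def using Suc.prems(1) u(1)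
        by (intro depth_le_sum depth_le_mult depth_le_power) auto
      have "{d<..Suc d} = {Suc d}" by auto
      then show "A d \<noteq> 0" using Suc.prems(2) u(2) by (simp add: A_def b_def)
      show "depth_le k (\<Sum>j\<le>d. A j * (z ^ p - z) ^ (p ^ j))"
        using Suc.prems(3) unfolding eq .
    qed
    then have "depth_le (Suc (k + d)) z" by (rule depth_le_artin_schreier[OF p])
    then show ?thesis using depth_le_mult[OF u(1)] unfolding x by simp
  qed
qed

section \<open>Algebraic elements satisfy additive equations\<close>

text \<open>Since \<open>P\<close> is monic with root \<open>x\<close>, all powers of \<open>x\<close> lie in the span of the first \<open>degree P\<close> ones.
  With distinct exponents, two of the chosen powers can still coincide; then their difference is the
  relation.\<close>

lemma powers_dependent:
  fixes h :: "'f::field \<Rightarrow> 'r::idom" and e :: "nat \<Rightarrow> nat"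
  assumes h: "h 0 = 0" "h 1 = 1" "\<And>a b. h (a + b) = h a + h b" "\<And>a b. h (a * b) = h a * h b"
    and P: "lead_coeff P = 1" "poly (map_poly h P) x = 0"
  obtains a i where "i \<le> degree P" "a i \<noteq> 0" "(\<Sum>i\<le>degree P. h (a i) * x ^ e i) = 0"
proof (cases "inj_on (\<lambda>i. x ^ e i) {..degree P}")
  case False
  then obtain i j where ij: "i \<le> degree P" "j \<le> degree P" "x ^ e i = x ^ e j" "i \<noteq> j"
    by (auto simp: inj_on_def)
  have hm: "h (- 1) = - 1" using h(3)[of 1 "- 1"] h(1,2) by (simp add: eq_neg_iff_add_eq_0 add.commute)
  define a where "a k = (if k = i then 1 else if k = j then - 1 else (0 :: 'f))" for k
  have "(\<Sum>k\<le>degree P. h (a k) * x ^ e k) = (\<Sum>k\<in>{i, j}. h (a k) * x ^ e k)"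
    by (rule sum.mono_neutral_right) (use ij h(1) in \<open>auto simp: a_def\<close>)
  also have "\<dots> = 0" using ij h(2) hm by (simp add: a_def)
  finally show thesis using that[of i a] ij(1) by (simp add: a_def)
next
  case True
  interpret vector_space "\<lambda>c y. h c * y"
    by unfold_locales (simp_all add: h algebra_simps)
  let ?n = "degree P" and ?B = "(\<lambda>i. x ^ i) ` {..<degree P}"
  have top: "x ^ ?n = - (\<Sum>i<?n. h (coeff P i) * x ^ i)"
  proof -
    have "degree (map_poly h P) = ?n"
      by (rule map_poly_degree_eq) (use P(1) h(2) in simp)
    then have "(\<Sum>i\<le>?n. h (coeff P i) * x ^ i) = 0"
      using P(2) by (simp add: poly_altdef coeff_map_poly h(1))
    moreover have "{..?n} = insert ?n {..<?n}" by auto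
    ultimately show ?thesis using P(1) h(2) by (simp add: eq_neg_iff_add_eq_0)
  qed
  have pow: "x ^ k \<in> span ?B" for k
  proof (induction k rule: less_induct)
    case (less k)
    show ?case
    proof (cases "k < ?n")
      case True
      then show ?thesis by (intro span_base) auto
    next
      case False
      then have "x ^ k = x ^ (k - ?n) * x ^ ?n" by (simp flip: power_add)
      also have "\<dots> = - (\<Sum>i<?n. h (coeff P i) * x ^ (k - ?n + i))"
        by (simp add: top sum_distrib_left power_add mult_ac)
      also have "\<dots> \<in> span ?B"
        using False by (intro span_neg span_sum span_scale less.IH) auto
      finally show ?thesis .
    qed
  qed
  let ?S = "(\<lambda>i. x ^ e i) ` {..?n}"
  have "dependent ?S"
  proof (rule ccontr)
    assume "independent ?S"
    then have "card ?S \<le> card ?B"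
      using independent_span_bound[of ?B ?S] pow by blast
    moreover have "card ?B \<le> ?n" using card_image_le[of "{..<?n}" "\<lambda>i. x ^ i"] by simp
    ultimately show False using card_image[OF True] by simp
  qed
  then obtain u where u: "\<exists>v\<in>?S. u v \<noteq> 0" "(\<Sum>v\<in>?S. h (u v) * v) = 0"
    unfolding dependent_finite[OF finite_imageI[OF finite_atMost]] by blast
  then show thesis
    using that[of _ "\<lambda>i. u (x ^ e i)"] sum.reindex[OF True, of "\<lambda>v. h (u v) * v"] by auto
qed

lemma depth_le_laurent_emb: "depth_le 0 (laurent_emb f)"
proof -
  have sub: "hahn_supp (laurent_emb f) \<subseteq> of_int ` {fls_subdegree f..}"
  proof
    fix g assume "g \<in> hahn_supp (laurent_emb f)"
    then obtain i where i: "g = of_int i" "fls_nth f i \<noteq> 0"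
      by (auto simp: hahn_supp_def laurent_emb.rep_eq elim!: Ints_cases split: if_splits)
    then show "g \<in> of_int ` {fls_subdegree f..}"
      using fls_subdegree_leI[OF i(2)] by simp
  qed
  have "finite (hahn_supp (laurent_emb f) \<inter> {..<B})" for B
  proof (rule finite_subset)
    show "hahn_supp (laurent_emb f) \<inter> {..<B} \<subseteq> of_int ` {fls_subdegree f..\<lceil>B\<rceil>}"
    proof
      fix g assume "g \<in> hahn_supp (laurent_emb f) \<inter> {..<B}"
      then obtain i where "g = of_int i" "fls_subdegree f \<le> i" "of_int i < B" using sub by auto
      moreover from this have "i \<le> \<lceil>B\<rceil>" by linarith
      ultimately show "g \<in> of_int ` {fls_subdegree f..\<lceil>B\<rceil>}" by simp
    qed
  qed simp
  moreover have "\<exists>m. \<forall>g\<in>hahn_supp (laurent_emb f). m \<le> g"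
    using sub by (intro exI[of _ "of_int (fls_subdegree f)"]) auto
  ultimately show ?thesis by (simp add: locally_shallow_def)
qed

lemma laurent_emb_eq_0_iff: "laurent_emb f = 0 \<longleftrightarrow> f = 0"
proof
  assume "laurent_emb f = 0"
  then have "laurent_emb (f * inverse f) = 0" by (simp add: laurent_emb_mult)
  then show "f = 0" by (metis laurent_emb_1 right_inverse zero_neq_one)
qed simp

theorem theorem4p5:
  fixes x :: "('p::prime_card mod_ring alg_closure, rat) hahn"
    and n m :: nat
  assumes "algebraic_over (laurent_emb :: 'p mod_ring fls \<Rightarrow> _) x"
    and "n = degree_over (laurent_emb :: 'p mod_ring fls \<Rightarrow> _) x"
    and "m = n * (n + 1) div 2 + 1"
  shows "(supp_order x, omega_pow m) \<in> ordLeq"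
proof -
  let ?h = "laurent_emb :: 'p mod_ring fls \<Rightarrow> _" and ?p = "CARD('p)"
  define P where "P = min_poly_over ?h x"
  have "is_min_poly_over ?h x P"
    unfolding P_def min_poly_over_def by (rule theI') (rule is_min_poly_over_laurent_ex1[OF assms(1)])
  then have P: "lead_coeff P = 1" "poly (map_poly ?h P) x = 0"
    by (simp_all add: is_min_poly_over_def)
  have n: "n = degree P" using assms(2) by (simp add: degree_over_def P_def)
  have "n > 0"
  proof (rule ccontr)
    assume "\<not> n > 0"
    then have "P = 1" using P(1) n by (metis monic_degree_0 not_gr_zero)
    then show False using P(2) by simp
  qed
  obtain a i where a: "i \<le> n" "a i \<noteq> 0" "(\<Sum>i\<le>n. ?h (a i) * x ^ (?p ^ i)) = 0"
    unfolding n
    by (rule powers_dependent[of ?h P x "\<lambda>i. ?p ^ i",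
          OF laurent_emb_0 laurent_emb_1 laurent_emb_add laurent_emb_mult P])
  define d where "d = Max {i. i \<le> n \<and> a i \<noteq> 0}"
  have fin: "finite {i. i \<le> n \<and> a i \<noteq> 0}" by simp
  have "d \<in> {i. i \<le> n \<and> a i \<noteq> 0}"
    unfolding d_def by (rule Max_in[OF fin]) (use a(1,2) in blast)
  then have d: "d \<le> n" "a d \<noteq> 0" by auto
  have "(\<Sum>i\<le>n. ?h (a i) * x ^ (?p ^ i)) = (\<Sum>i\<le>d. ?h (a i) * x ^ (?p ^ i))"
  proof (rule sum.mono_neutral_right)
    show "\<forall>i\<in>{..n} - {..d}. ?h (a i) * x ^ (?p ^ i) = 0"
    proof
      fix i assume "i \<in> {..n} - {..d}"
      then have "a i = 0" using Max_ge[OF fin, of i] by (auto simp: d_def)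
      then show "?h (a i) * x ^ (?p ^ i) = 0" by simp
    qed
  qed (use d in auto)
  then have "depth_le 0 (\<Sum>i\<le>d. ?h (a i) * x ^ (?p ^ i))" using a(3) by simp
  then have "depth_le (0 + d) x"
    by (intro depth_le_if_additive_equation[where p = ?p and a = "\<lambda>i. ?h (a i)"])
      (use d in \<open>simp_all add: prime_card depth_le_laurent_emb laurent_emb_eq_0_iff\<close>)
  moreover have "n \<le> n * (n + 1) div 2"
    using \<open>n > 0\<close> by (cases n) auto
  ultimately have "depth_le (n * (n + 1) div 2) x"
    using locally_shallow_mono d(1) by (metis add_0 le_trans)
  then show ?thesis
    using locally_shallow_ordLeq[OF _ well_ordered_supp] unfolding supp_order_def assms(3) by simp
qed

end
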